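(* Consider the sparse linear Gaussian model: $S\in\{1,\dots,N\}$, $\mathcal{X}_S=\{\mathbf{x}\in\mathbb{R}^N:\|\mathbf{x}\|_0\le S\}$, $\mathbf{H}\in\mathbb{R}^{M\times N}$ with $\operatorname{spark}(\mathbf{H})>S$, $\sigma>0$, observation $\mathbf{y}=\mathbf{H}\mathbf{x}+\mathbf{n}$, $\mathbf{n}\sim\mathcal{N}(\mathbf{0},\sigma^2\mathbf{I})$, a parameter function $g:\mathcal{X}_S\to\mathbb{R}$, and $\mathbf{x}_0\in\mathcal{X}_S$. Let $D=\operatorname{rank}(\mathbf{H})$, $\mathbf{H}=\mathbf{U}\mathbf{\Sigma}\mathbf{V}^T$ a thin SVD and $\widetilde{\mathbf{H}}=\mathbf{V}\mathbf{\Sigma}^{-1}$. Let $c:\mathcal{X}_S\to\mathbb{R}$ be a bias function valid at $\mathbf{x}_0$, $\gamma=c+g$, and let $\mathcal{C}(c)\subseteq\ell^2(\mathbb{Z}_+^D)$ be the set of sequences $a$ such that for all $\mathbf{x}\in\mathcal{X}_S$ $$c(\mathbf{x})=\exp\Big(\tfrac{1}{2\sigma^2}\|\mathbf{H}\mathbf{x}_0\|_2^2-\tfrac{1}{\sigma^2}\mathbf{x}^T\mathbf{H}^T\mathbf{H}\mathbf{x}_0\Big)\sum_{\mathbf{p}\in\mathbb{Z}_+^D}\frac{a[\mathbf{p}]}{\sqrt{\mathbf{p}!}}\Big(\tfrac{1}{\sigma}\widetilde{\mathbf{H}}^{\dagger}\mathbf{x}\Big)^{\mathbf{p}}-g(\mathbf{x}).$$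 Define $\rho_{\mathbf{x}_0}(\mathbf{y},\mathbf{x})=\exp\big(-\tfrac{1}{2\sigma^2}[2\mathbf{y}^T\mathbf{H}(\mathbf{x}_0-\mathbf{x})+\|\mathbf{H}\mathbf{x}\|_2^2-\|\mathbf{H}\mathbf{x}_0\|_2^2]\big)$ for $\mathbf{x}\in\mathbb{R}^N$ and $$\chi_{\mathbf{p}}(\mathbf{y})=\frac{\partial^{\mathbf{p}}}{\partial\mathbf{z}^{\mathbf{p}}}\Big[\rho_{\mathbf{x}_0}(\mathbf{y},\sigma\widetilde{\mathbf{H}}\mathbf{z})\exp\big(\tfrac{1}{\sigma}\mathbf{x}_0^T\mathbf{H}^T\mathbf{H}\widetilde{\mathbf{H}}\mathbf{z}\big)\Big]\Big|_{\mathbf{z}=\mathbf{0}},\quad\mathbf{p}\in\mathbb{Z}_+^D.$$ Then: (1) The minimum achievable variance at $\mathbf{x}_0$ equals $M(c,\mathbf{x}_0)=\min_{a\in\mathcal{C}(c)}\sum_{\mathbf{p}\in\mathbb{Z}_+^D}a^2[\mathbf{p}]-\gamma^2(\mathbf{x}_0)$ (the minimum being attained). (2) For every $a\in\mathcal{C}(c)$, the estimator $\hat g(\mathbf{y})=\exp\big(-\tfrac{1}{2\sigma^2}\|\mathbf{H}\mathbf{x}_0\|_2^2\big)\sum_{\mathbf{p}\in\mathbb{Z}_+^D}\frac{a[\mathbf{p}]}{\sqrt{\mathbf{p}!}}\chi_{\mathbf{p}}(\mathbf{y})$ has finite variance at $\mathbf{x}_0$ and bias function equal to $c$ on $\mathcal{X}_S$.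 (3) The LMV estimator at $\mathbf{x}_0$ for $c$ is the estimator in (2) with $a=a_0=\arg\min_{a\in\mathcal{C}(c)}\|a\|_{\ell^2(\mathbb{Z}_+^D)}$.
   Context: $\|\cdot\|_0$ = number of nonzero entries; $\operatorname{spark}$ = minimum number of linearly dependent columns; $\dagger$ = Moore–Penrose pseudoinverse; multi-index notation $\mathbf{p}!=\prod p_l!$, $\mathbf{z}^{\mathbf{p}}=\prod z_l^{p_l}$, $\partial^{\mathbf{p}}/\partial\mathbf{z}^{\mathbf{p}}=\prod_l\partial^{p_l}/\partial z_l^{p_l}$. An estimator $\hat g:\mathbb{R}^M\to\mathbb{R}$ has bias $b(\hat g;\mathbf{x})=\mathsf{E}_{\mathbf{x}}\{\hat g(\mathbf{y})\}-g(\mathbf{x})$ and variance $v(\hat g;\mathbf{x})=\mathsf{E}_{\mathbf{x}}\{(\hat g(\mathbf{y})-\mathsf{E}_{\mathbf{x}}\hat g(\mathbf{y}))^2\}$. $c$ is valid at $\mathbf{x}_0$ if the set $\mathcal{A}(c,\mathbf{x}_0)$ of estimators with $v(\hat g;\mathbf{x}_0)<\infty$ and $b(\hat g;\mathbf{x})=c(\mathbf{x})$ for all $\mathbf{x}\in\mathcal{X}_S$ is nonempty; the minimum achievable variance is $M(c,\mathbf{x}_0)=\inf_{\hat g\in\mathcal{A}(c,\mathbf{x}_0)}v(\hat g;\mathbf{x}_0)$, and an LMV (locally minimum variance) estimator is an element of $\mathcal{A}(c,\mathbf{x}_0)$ attaining this infimum. *)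

theory Defs
  imports "HOL-Probability.Probability"
begin

definition l0 :: "real^'n \<Rightarrow> nat" where
  "l0 x = card {i. x $ i \<noteq> 0}"

definition sparse_set :: "nat \<Rightarrow> (real^'n) set" where
  "sparse_set S = {x. l0 x \<le> S}"

definition dep_cols :: "real^'n^'m \<Rightarrow> 'n set \<Rightarrow> bool" where
  "dep_cols H J \<longleftrightarrow> (\<exists>w::'n \<Rightarrow> real. (\<exists>j\<in>J. w j \<noteq> 0) \<and>
                         (\<Sum>j\<in>J. w j *\<^sub>R column j H) = 0)"

definition spark :: "real^'n^'m \<Rightarrow> nat" where
  "spark H = (if \<exists>J. J \<noteq> {} \<and> dep_cols H J
              then (LEAST k. \<exists>J. card J = k \<and> J \<noteq> {} \<and> dep_cols H J)
              else CARD('n) + 1)"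

definition pinv :: "real^'b^'a \<Rightarrow> real^'a^'b" where
  "pinv A = (THE X. A ** X ** A = A \<and> X ** A ** X = X \<and>
                    transpose (A ** X) = A ** X \<and> transpose (X ** A) = X ** A)"

text \<open>Thin SVD H = U Sigma V^T with D = CARD('d) = rank H.\<close>
definition thin_svd :: "real^'n^'m \<Rightarrow> real^'d^'m \<Rightarrow> real^'d^'d \<Rightarrow> real^'d^'n \<Rightarrow> bool" where
  "thin_svd H U Sg V \<longleftrightarrow> H = U ** Sg ** transpose V \<and>
     transpose U ** U = mat 1 \<and> transpose V ** V = mat 1 \<and>
     (\<forall>i j. i \<noteq> j \<longrightarrow> Sg $ i $ j = 0) \<and> (\<forall>i. Sg $ i $ i > 0)"

definition obs :: "real \<Rightarrow> real^'n^'m \<Rightarrow> real^'n \<Rightarrow> (real^'m) measure" where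
  "obs \<sigma> H x = density lborel
     (\<lambda>y. ennreal (\<Prod>i\<in>UNIV. normal_density ((H *v x) $ i) \<sigma> (y $ i)))"

definition mean_est :: "real \<Rightarrow> real^'n^'m \<Rightarrow> real^'n \<Rightarrow> (real^'m \<Rightarrow> real) \<Rightarrow> real" where
  "mean_est \<sigma> H x gh = (LINT y|obs \<sigma> H x. gh y)"

definition var_est :: "real \<Rightarrow> real^'n^'m \<Rightarrow> real^'n \<Rightarrow> (real^'m \<Rightarrow> real) \<Rightarrow> real" where
  "var_est \<sigma> H x gh = (LINT y|obs \<sigma> H x. (gh y - mean_est \<sigma> H x gh)\<^sup>2)"

definition finite_var :: "real \<Rightarrow> real^'n^'m \<Rightarrow> real^'n \<Rightarrow> (real^'m \<Rightarrow> real) \<Rightarrow> bool" where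
  "finite_var \<sigma> H x gh \<longleftrightarrow> gh \<in> borel_measurable borel \<and>
      integrable (obs \<sigma> H x) (\<lambda>y. (gh y)\<^sup>2)"

definition admissible :: "real \<Rightarrow> real^'n^'m \<Rightarrow> nat \<Rightarrow> (real^'n \<Rightarrow> real) \<Rightarrow>
    (real^'n \<Rightarrow> real) \<Rightarrow> real^'n \<Rightarrow> (real^'m \<Rightarrow> real) set" where
  "admissible \<sigma> H S g c x0 = {gh. finite_var \<sigma> H x0 gh \<and>
      (\<forall>x\<in>sparse_set S. integrable (obs \<sigma> H x) gh \<and> mean_est \<sigma> H x gh - g x = c x)}"

definition valid_bias where
  "valid_bias \<sigma> H S g c x0 \<longleftrightarrow> admissible \<sigma> H S g c x0 \<noteq> {}"

definition min_var where
  "min_var \<sigma> H S g c x0 = Inf (var_est \<sigma> H x0 ` admissible \<sigma> H S g c x0)"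

definition is_LMV where
  "is_LMV \<sigma> H S g c x0 gh \<longleftrightarrow> gh \<in> admissible \<sigma> H S g c x0 \<and>
      var_est \<sigma> H x0 gh = min_var \<sigma> H S g c x0"

definition mfact :: "('d::finite \<Rightarrow> nat) \<Rightarrow> real" where
  "mfact p = (\<Prod>i\<in>UNIV. fact (p i))"

definition mpow :: "real^'d \<Rightarrow> ('d::finite \<Rightarrow> nat) \<Rightarrow> real" where
  "mpow z p = (\<Prod>i\<in>UNIV. (z $ i) ^ p i)"

definition partial :: "'d \<Rightarrow> (real^'d \<Rightarrow> real) \<Rightarrow> real^'d \<Rightarrow> real" where
  "partial i f = (\<lambda>z. deriv (\<lambda>t. f (z + t *\<^sub>R axis i 1)) 0)"

definition mixed_deriv :: "('d::finite \<Rightarrow> nat) \<Rightarrow> (real^'d \<Rightarrow> real) \<Rightarrow> real^'d \<Rightarrow> real" where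
  "mixed_deriv p f = foldr (\<lambda>i h. (partial i ^^ p i) h)
      (SOME xs. distinct xs \<and> set xs = (UNIV::'d set)) f"

definition l2 :: "(('d::finite \<Rightarrow> nat) \<Rightarrow> real) \<Rightarrow> bool" where
  "l2 a \<longleftrightarrow> (\<lambda>p. (a p)\<^sup>2) summable_on UNIV"

definition l2norm :: "(('d::finite \<Rightarrow> nat) \<Rightarrow> real) \<Rightarrow> real" where
  "l2norm a = sqrt (\<Sum>\<^sub>\<infinity>p. (a p)\<^sup>2)"

text \<open>The set C(c) of coefficient sequences, with Ht = V Sigma^-1.\<close>
definition coef_set :: "real \<Rightarrow> real^'n^'m \<Rightarrow> nat \<Rightarrow> (real^'n \<Rightarrow> real) \<Rightarrow>
    (real^'n \<Rightarrow> real) \<Rightarrow> real^'n \<Rightarrow> real^'d::finite^'n \<Rightarrow> (('d \<Rightarrow> nat) \<Rightarrow> real) set" where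
  "coef_set \<sigma> H S g c x0 Ht = {a. l2 a \<and> (\<forall>x\<in>sparse_set S.
      c x = exp ((1 / (2 * \<sigma>\<^sup>2)) * (norm (H *v x0))\<^sup>2 - (1 / \<sigma>\<^sup>2) * ((H *v x) \<bullet> (H *v x0)))
            * (\<Sum>\<^sub>\<infinity>p. a p / sqrt (mfact p) * mpow ((1 / \<sigma>) *\<^sub>R (pinv Ht *v x)) p)
            - g x)}"

definition rho :: "real \<Rightarrow> real^'n^'m \<Rightarrow> real^'n \<Rightarrow> real^'m \<Rightarrow> real^'n \<Rightarrow> real" where
  "rho \<sigma> H x0 y x = exp (- (1 / (2 * \<sigma>\<^sup>2)) *
      (2 * (y \<bullet> (H *v (x0 - x))) + (norm (H *v x))\<^sup>2 - (norm (H *v x0))\<^sup>2))"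

definition chi :: "real \<Rightarrow> real^'n^'m \<Rightarrow> real^'n \<Rightarrow> real^'d::finite^'n \<Rightarrow>
    ('d \<Rightarrow> nat) \<Rightarrow> real^'m \<Rightarrow> real" where
  "chi \<sigma> H x0 Ht p y = mixed_deriv p
      (\<lambda>z. rho \<sigma> H x0 y (\<sigma> *\<^sub>R (Ht *v z)) *
           exp ((1 / \<sigma>) * ((H *v x0) \<bullet> (H *v (Ht *v z))))) 0"

text \<open>The series  exp(-|Hx0|^2/(2 sigma^2)) * sum_p a[p]/sqrt(p!) chi_p(y), understood as an
  unconditional limit of finite partial sums in L2(P_x0): gh is such a sum.\<close>
definition est_term where
  "est_term \<sigma> H x0 Ht a p = (\<lambda>y. exp (- (norm (H *v x0))\<^sup>2 / (2 * \<sigma>\<^sup>2)) *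
       (a p / sqrt (mfact p) * chi \<sigma> H x0 Ht p y))"

definition is_series_estimator where
  "is_series_estimator \<sigma> H x0 Ht a gh \<longleftrightarrow> gh \<in> borel_measurable borel \<and>
     (\<forall>\<epsilon>>0. \<exists>F0. finite F0 \<and> (\<forall>F. finite F \<and> F0 \<subseteq> F \<longrightarrow>
        integrable (obs \<sigma> H x0) (\<lambda>y. (gh y - (\<Sum>p\<in>F. est_term \<sigma> H x0 Ht a p y))\<^sup>2) \<and>
        (LINT y|obs \<sigma> H x0. (gh y - (\<Sum>p\<in>F. est_term \<sigma> H x0 Ht a p y))\<^sup>2) < \<epsilon>))"

end

(* With mu = H x0, the functions k(y) He_p(w) / sqrt(p!), where k(y) = exp(-<y, mu> / sigma^2),
   w = U^T (y + mu) / sigma and He_p is a product of Hermite polynomials, are orthonormal in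
   L^2(P_x0): k^2 times the density with mean mu is the density with mean -mu, under which w is
   standard normal.  They are the functions appearing in the series estimator.  By the generating
   function of the Hermite polynomials every likelihood ratio rho(., x) lies in their closed span,
   with coefficients proportional to z^p / sqrt(p!), z = pinv(Ht) x / sigma.  Unbiasedness for c is
   the system of equations <g, rho(., x)> = gamma(x).  Passing to the coefficients of g preserves
   these equations and does not increase the norm, and series expansion goes back isometrically.
   Hence both minimisation problems have the same value, and existence and uniqueness of the
   minimisers follow from completeness of L^2 and the parallelogram law.  *)
theory Submission
  imports Defs "HOL-Computational_Algebra.Polynomial"
begin

section \<open>Square-integrable functions\<close>

text \<open>The variance can be traded for the second moment because \<open>x0\<close> is itself
  sparse: all competitors have the same mean gamma(x0) there. Square integrability at
  \<open>x0\<close> alone then controls every other parameter, since each likelihood ratio is square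
  integrable and turns an expectation under x into an inner product at \<open>x0\<close>. The
  obstacle is that the Hermite functions need not be total: only the D directions in the range of
  \<open>U\<close> enter, so a general estimator has coefficients but perhaps no expansion. For such
  an estimator only Bessel's inequality is available, and its direction is exactly what the
  comparison of the two minima needs. The likelihood ratios do expand, and this too is shown without
  totality, by checking equality in Bessel's inequality, where both sides are explicit exponentials.
  Elements of L^2 are functions, not classes, so uniqueness of estimators holds up to null sets,
  while the minimising coefficient sequence is unique outright.\<close>

definition sqint :: "'a measure \<Rightarrow> ('a \<Rightarrow> real) set" where
  "sqint M = {f. f \<in> borel_measurable M \<and> integrable M (\<lambda>x. (f x)\<^sup>2)}"

lemma sqint_borel: "f \<in> sqint M \<Longrightarrow> f \<in> borel_measurable M"
  and sqint_integrable_square: "f \<in> sqint M \<Longrightarrow> integrable M (\<lambda>x. (f x)\<^sup>2)"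
  by (auto simp: sqint_def)

lemma sqint_integrable_mult:
  assumes "f \<in> sqint M" "g \<in> sqint M"
  shows "integrable M (\<lambda>x. f x * g x)"
proof (rule Bochner_Integration.integrable_bound)
  show "integrable M (\<lambda>x. (f x)\<^sup>2 + (g x)\<^sup>2)"
    using assms by (auto simp: sqint_def)
  show "(\<lambda>x. f x * g x) \<in> borel_measurable M"
    using assms by (auto simp: sqint_def)
  have "\<bar>a * b\<bar> \<le> \<bar>a\<^sup>2 + b\<^sup>2\<bar>" for a b :: real
  proof -
    have "2 * \<bar>a * b\<bar> \<le> a\<^sup>2 + b\<^sup>2"
      using sum_squares_bound[of "\<bar>a\<bar>" "\<bar>b\<bar>"] by (simp add: abs_mult)
    thus ?thesis by linarith
  qed
  thus "AE x in M. norm (f x * g x) \<le> norm ((f x)\<^sup>2 + (g x)\<^sup>2)"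
    by simp
qed

lemma sqint_cmult: "f \<in> sqint M \<Longrightarrow> (\<lambda>x. c * f x) \<in> sqint M"
  by (auto simp: sqint_def power_mult_distrib)

lemma sqint_add:
  assumes "f \<in> sqint M" "g \<in> sqint M"
  shows "(\<lambda>x. f x + g x) \<in> sqint M"
proof -
  have "integrable M (\<lambda>x. (f x)\<^sup>2 + (g x)\<^sup>2 + 2 * (f x * g x))"
    using assms sqint_integrable_mult[OF assms] by (auto simp: sqint_def)
  thus ?thesis
    using assms by (auto simp: sqint_def power2_sum algebra_simps)
qed

lemma sqint_diff: "f \<in> sqint M \<Longrightarrow> g \<in> sqint M \<Longrightarrow> (\<lambda>x. f x - g x) \<in> sqint M"
  using sqint_add[of f M "\<lambda>x. (-1) * g x"] sqint_cmult[of g M "-1"] by simp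

lemma sqint_sum: "(\<And>i. i \<in> F \<Longrightarrow> f i \<in> sqint M) \<Longrightarrow> (\<lambda>x. \<Sum>i\<in>F. f i x) \<in> sqint M"
proof (induction F rule: infinite_finite_induct)
  case (insert i F)
  thus ?case by (auto intro!: sqint_add)
qed (auto simp: sqint_def)

lemma integral_square_add:
  assumes "f \<in> sqint M" "g \<in> sqint M"
  shows "(LINT x|M. (f x + t * g x)\<^sup>2) =
    (LINT x|M. (f x)\<^sup>2) + 2 * t * (LINT x|M. f x * g x) + t\<^sup>2 * (LINT x|M. (g x)\<^sup>2)"
proof -
  have "(LINT x|M. (f x + t * g x)\<^sup>2) = (LINT x|M. (f x)\<^sup>2 + (2 * t) * (f x * g x) + t\<^sup>2 * (g x)\<^sup>2)"
    by (simp add: power2_sum power_mult_distrib algebra_simps)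
  also have "\<dots> = (LINT x|M. (f x)\<^sup>2) + 2 * t * (LINT x|M. f x * g x) + t\<^sup>2 * (LINT x|M. (g x)\<^sup>2)"
    using assms sqint_integrable_mult[OF assms] by (simp add: sqint_integrable_square)
  finally show ?thesis .
qed

lemma integral_square_diff:
  assumes "f \<in> sqint M" "g \<in> sqint M"
  shows "(LINT x|M. (f x - g x)\<^sup>2) =
    (LINT x|M. (f x)\<^sup>2) - 2 * (LINT x|M. f x * g x) + (LINT x|M. (g x)\<^sup>2)"
  using integral_square_add[OF assms, of "-1"] by simp

lemma integral_square_nonneg: "0 \<le> (LINT x|M. (f x)\<^sup>2 :: real)"
  by simp

text \<open>The squared norm of f + t g is a quadratic in t that never becomes negative; its value
  at the minimiser t = - B / C is the claim. For C = 0 the quadratic is affine, which forces B =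
  0.\<close>

lemma L2_Cauchy_Schwarz:
  assumes "f \<in> sqint M" "g \<in> sqint M"
  shows "(LINT x|M. f x * g x)\<^sup>2 \<le> (LINT x|M. (f x)\<^sup>2) * (LINT x|M. (g x)\<^sup>2)"
proof -
  define A B C where "A = (LINT x|M. (f x)\<^sup>2)" and "B = (LINT x|M. f x * g x)"
    and "C = (LINT x|M. (g x)\<^sup>2)"
  have *: "0 \<le> A + 2 * t * B + t\<^sup>2 * C" for t
    using integral_square_nonneg[of M "\<lambda>x. f x + t * g x"]
    unfolding integral_square_add[OF assms] A_def B_def C_def .
  have "C \<ge> 0" by (simp add: C_def)
  show ?thesis
  proof (cases "C = 0")
    case True
    have "B = 0"
    proof (rule ccontr)
      assume "B \<noteq> 0"
      \<comment> \<open>At this t the affine function takes the value A - (A + 1) = -1.\<close>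
      thus False
        using *[of "- (A + 1) / (2 * B)"] True by (simp add: field_simps)
    qed
    thus ?thesis using True by (simp add: A_def B_def C_def)
  next
    case False
    with \<open>C \<ge> 0\<close> have "C > 0" by simp
    have "0 \<le> A - B\<^sup>2 / C"
      using *[of "- B / C"] \<open>C > 0\<close> by (simp add: field_simps power2_eq_square)
    thus ?thesis
      using \<open>C > 0\<close> by (simp add: A_def B_def C_def field_simps)
  qed
qed

section \<open>Convergence and completeness in L^2 of a probability space\<close>

definition L2_tendsto :: "'a measure \<Rightarrow> (nat \<Rightarrow> 'a \<Rightarrow> real) \<Rightarrow> ('a \<Rightarrow> real) \<Rightarrow> bool" where
  "L2_tendsto M f g \<longleftrightarrow> (\<forall>n. f n \<in> sqint M) \<and> g \<in> sqint M \<and>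
     (\<lambda>n. LINT x|M. (f n x - g x)\<^sup>2) \<longlonglongrightarrow> 0"

lemma L2_tendsto_inner:
  assumes "L2_tendsto M f g" "h \<in> sqint M"
  shows "(\<lambda>n. LINT x|M. f n x * h x) \<longlonglongrightarrow> (LINT x|M. g x * h x)"
proof -
  have sq: "f n \<in> sqint M" "g \<in> sqint M" for n
    using assms(1) by (auto simp: L2_tendsto_def)
  have lim: "(\<lambda>n. LINT x|M. (f n x - g x)\<^sup>2) \<longlonglongrightarrow> 0"
    using assms(1) by (simp add: L2_tendsto_def)
  have eq: "(LINT x|M. f n x * h x) - (LINT x|M. g x * h x) = (LINT x|M. (f n x - g x) * h x)" for n
    using sq assms(2) by (simp add: sqint_integrable_mult left_diff_distrib)
  have "(\<lambda>n. ((LINT x|M. f n x * h x) - (LINT x|M. g x * h x))\<^sup>2) \<longlonglongrightarrow> 0"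
  proof (rule tendsto_sandwich[OF _ _ tendsto_const])
    show "(\<lambda>n. (LINT x|M. (f n x - g x)\<^sup>2) * (LINT x|M. (h x)\<^sup>2)) \<longlonglongrightarrow> 0"
      using tendsto_mult_left_zero[OF lim] .
    show "\<forall>\<^sub>F n in sequentially. ((LINT x|M. f n x * h x) - (LINT x|M. g x * h x))\<^sup>2
        \<le> (LINT x|M. (f n x - g x)\<^sup>2) * (LINT x|M. (h x)\<^sup>2)"
      unfolding eq by (intro always_eventually allI L2_Cauchy_Schwarz sqint_diff sq assms(2))
  qed auto
  hence "(\<lambda>n. (LINT x|M. f n x * h x) - (LINT x|M. g x * h x)) \<longlonglongrightarrow> 0"
    by (simp add: tendsto_null_power)
  thus ?thesis by (simp add: LIM_zero_iff)
qed

text \<open>On a probability space Cauchy-Schwarz against the constant 1 makes an L^2-Cauchy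
  sequence L^1-Cauchy, so a subsequence converges almost everywhere. Fatou's lemma then shows that
  this pointwise limit is also the L^2 limit.\<close>

lemma (in prob_space) L2_complete:
  assumes sq: "\<And>n. f n \<in> sqint M"
    and cau: "\<And>\<epsilon>. \<epsilon> > 0 \<Longrightarrow> \<exists>N. \<forall>m\<ge>N. \<forall>n\<ge>N. (LINT x|M. (f m x - f n x)\<^sup>2) < \<epsilon>"
  shows "\<exists>g. L2_tendsto M f g"
proof -
  have meas[measurable]: "f n \<in> borel_measurable M" for n
    using sq by (rule sqint_borel)
  have one: "(\<lambda>x. 1) \<in> sqint M" by (simp add: sqint_def)
  have abs_sq: "(\<lambda>x. \<bar>f m x - f n x\<bar>) \<in> sqint M" for m n
    using sqint_diff[OF sq sq, of m n] by (simp add: sqint_def)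
  obtain r where r: "strict_mono r" "AE x in M. Cauchy (\<lambda>i. f (r i) x)"
  proof (rule cauchy_L1_AE_cauchy_subseq)
    show "integrable M (f n)" for n
      using square_integrable_imp_integrable[OF meas sqint_integrable_square[OF sq]] .
    fix e :: real assume "e > 0"
    then obtain N where N: "\<forall>m\<ge>N. \<forall>n\<ge>N. (LINT x|M. (f m x - f n x)\<^sup>2) < e\<^sup>2"
      using cau[of "e\<^sup>2"] by auto
    have "(LINT x|M. norm (f m x - f n x)) < e" if "m \<ge> N" "n \<ge> N" for m n
    proof -
      have "(LINT x|M. norm (f m x - f n x))\<^sup>2 \<le> (LINT x|M. (f m x - f n x)\<^sup>2)"
        using L2_Cauchy_Schwarz[OF abs_sq one, of m n] by (simp add: prob_space)
      also have "\<dots> < e\<^sup>2" using N that by auto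
      finally show ?thesis using \<open>e > 0\<close> by (simp add: power2_less_imp_less)
    qed
    thus "\<exists>N. \<forall>i\<ge>N. \<forall>j\<ge>N. (LINT x|M. norm (f i x - f j x)) < e" by blast
  qed
  define g where "g x = lim (\<lambda>i. f (r i) x)" for x
  have g_meas[measurable]: "g \<in> borel_measurable M"
    unfolding g_def by measurable
  have conv: "AE x in M. (\<lambda>i. f (r i) x) \<longlonglongrightarrow> g x"
    using r(2) by eventually_elim (simp add: g_def Cauchy_convergent_iff convergent_LIMSEQ_iff)
  \<comment> \<open>Fatou along the subsequence: \<open>r i\<close> is at least \<open>i\<close>, so
    from index \<open>N\<close> on all the distances \<open>f n - f (r i)\<close> satisfy the Cauchy
    bound.\<close>
  have key: "(\<integral>\<^sup>+x. (f n x - g x)\<^sup>2 \<partial>M) \<le> ennreal \<epsilon>"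
    if "\<epsilon> > 0" "\<And>k. k \<ge> N \<Longrightarrow> (LINT x|M. (f n x - f k x)\<^sup>2) < \<epsilon>" for n N \<epsilon>
  proof -
    have "(\<integral>\<^sup>+x. (f n x - g x)\<^sup>2 \<partial>M) = (\<integral>\<^sup>+x. liminf (\<lambda>i. ennreal ((f n x - f (r i) x)\<^sup>2)) \<partial>M)"
    proof (rule nn_integral_cong_AE, use conv in eventually_elim)
      case (elim x)
      have "(\<lambda>i. ennreal ((f n x - f (r i) x)\<^sup>2)) \<longlonglongrightarrow> ennreal ((f n x - g x)\<^sup>2)"
        using elim by (intro tendsto_ennrealI tendsto_intros)
      from lim_imp_Liminf[OF trivial_limit_sequentially this] show ?case by simp
    qed
    also have "\<dots> \<le> liminf (\<lambda>i. \<integral>\<^sup>+x. ennreal ((f n x - f (r i) x)\<^sup>2) \<partial>M)"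
      by (rule nn_integral_liminf) measurable
    also have "\<dots> \<le> ennreal \<epsilon>"
    proof -
      have "\<forall>\<^sub>F i in sequentially. (\<integral>\<^sup>+x. ennreal ((f n x - f (r i) x)\<^sup>2) \<partial>M) \<le> ennreal \<epsilon>"
      proof (rule eventually_sequentiallyI)
        fix i assume "i \<ge> N"
        with seq_suble[OF r(1), of i] have "r i \<ge> N" by simp
        have "(\<integral>\<^sup>+x. ennreal ((f n x - f (r i) x)\<^sup>2) \<partial>M) = ennreal (LINT x|M. (f n x - f (r i) x)\<^sup>2)"
          by (rule nn_integral_eq_integral) (auto intro: sqint_integrable_square[OF sqint_diff[OF sq sq]])
        also have "\<dots> \<le> ennreal \<epsilon>"
          using that(2)[OF \<open>r i \<ge> N\<close>] by (intro ennreal_leI) simp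
        finally show "(\<integral>\<^sup>+x. ennreal ((f n x - f (r i) x)\<^sup>2) \<partial>M) \<le> ennreal \<epsilon>" .
      qed
      hence "liminf (\<lambda>i. \<integral>\<^sup>+x. ennreal ((f n x - f (r i) x)\<^sup>2) \<partial>M) \<le> liminf (\<lambda>i::nat. ennreal \<epsilon>)"
        by (rule Liminf_mono)
      thus ?thesis by (simp add: Liminf_const)
    qed
    finally show ?thesis .
  qed
  have key2: "(\<lambda>x. f n x - g x) \<in> sqint M \<and> (LINT x|M. (f n x - g x)\<^sup>2) \<le> \<epsilon>"
    if "\<epsilon> > 0" "\<And>k. k \<ge> N \<Longrightarrow> (LINT x|M. (f n x - f k x)\<^sup>2) < \<epsilon>" for n N \<epsilon>
  proof
    have "(\<integral>\<^sup>+x. (f n x - g x)\<^sup>2 \<partial>M) < \<infinity>"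
      using le_less_trans[OF key[OF that] ennreal_less_top] by simp
    hence int: "integrable M (\<lambda>x. (f n x - g x)\<^sup>2)"
      by (intro integrableI_bounded) auto
    thus "(\<lambda>x. f n x - g x) \<in> sqint M" by (simp add: sqint_def)
    have "ennreal (LINT x|M. (f n x - g x)\<^sup>2) \<le> ennreal \<epsilon>"
      using key[OF that] by (subst nn_integral_eq_integral[symmetric]) (auto intro: int)
    thus "(LINT x|M. (f n x - g x)\<^sup>2) \<le> \<epsilon>" using \<open>\<epsilon> > 0\<close> by simp
  qed
  obtain N1 where N1: "\<forall>m\<ge>N1. \<forall>n\<ge>N1. (LINT x|M. (f m x - f n x)\<^sup>2) < 1"
    using cau[of 1] by auto
  have "(\<lambda>x. f N1 x - g x) \<in> sqint M" using key2[of 1 N1 N1] N1 by auto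
  from sqint_diff[OF sq this, of N1] have g_sq: "g \<in> sqint M" by simp
  have "(\<lambda>n. LINT x|M. (f n x - g x)\<^sup>2) \<longlonglongrightarrow> 0"
  proof (rule LIMSEQ_I)
    fix e :: real assume "e > 0"
    obtain N where N: "\<forall>m\<ge>N. \<forall>n\<ge>N. (LINT x|M. (f m x - f n x)\<^sup>2) < e / 2"
      using cau[of "e / 2"] \<open>e > 0\<close> by auto
    have "(LINT x|M. (f n x - g x)\<^sup>2) \<le> e / 2" if "n \<ge> N" for n
      using key2[of "e / 2" N n] N that \<open>e > 0\<close> by auto
    thus "\<exists>no. \<forall>n\<ge>no. norm ((LINT x|M. (f n x - g x)\<^sup>2) - 0) < e"
      using \<open>e > 0\<close> by (intro exI[of _ N]) force
  qed
  thus ?thesis using sq g_sq by (auto simp: L2_tendsto_def)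
qed

text \<open>Arranged around the midpoint, because the sets of interest are affine: the midpoint
  stays inside, so its norm is bounded below by the infimum and the distance of two near-minimisers
  is small.\<close>

lemma sqint_parallelogram:
  assumes "f \<in> sqint M" "g \<in> sqint M"
  shows "(LINT x|M. (f x - g x)\<^sup>2) =
    2 * (LINT x|M. (f x)\<^sup>2) + 2 * (LINT x|M. (g x)\<^sup>2) - 4 * (LINT x|M. ((1/2) * (f x + g x))\<^sup>2)"
proof -
  have "(LINT x|M. ((1/2) * (f x + g x))\<^sup>2) = (1/4) * (LINT x|M. (f x + g x)\<^sup>2)"
    by (subst integral_mult_right_zero[symmetric]) (simp add: power2_eq_square)
  thus ?thesis
    using integral_square_add[OF assms, of 1] integral_square_diff[OF assms] by simp
qed

text \<open>A closed affine subspace of L^2 when the \<open>r x\<close> are square integrable. In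
  the application \<open>r x\<close> is the likelihood ratio at x and \<open>t\<close> is gamma, and
  the members are the estimators with bias c and finite variance at \<open>x0\<close>.\<close>

definition moment_set ::
  "'a measure \<Rightarrow> 'x set \<Rightarrow> ('x \<Rightarrow> 'a \<Rightarrow> real) \<Rightarrow> ('x \<Rightarrow> real) \<Rightarrow> ('a \<Rightarrow> real) set" where
  "moment_set M X r t = {f \<in> sqint M. \<forall>x\<in>X. (LINT y|M. f y * r x y) = t x}"

lemma moment_set_midpoint:
  assumes "\<And>x. x \<in> X \<Longrightarrow> r x \<in> sqint M" "f \<in> moment_set M X r t" "g \<in> moment_set M X r t"
  shows "(\<lambda>y. (1/2) * (f y + g y)) \<in> moment_set M X r t"
proof -
  have sq: "f \<in> sqint M" "g \<in> sqint M" using assms by (auto simp: moment_set_def)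
  have "(LINT y|M. (1/2) * (f y + g y) * r x y) = t x" if "x \<in> X" for x
  proof -
    have "(LINT y|M. (1/2) * (f y + g y) * r x y)
        = (LINT y|M. (1/2) * (f y * r x y) + (1/2) * (g y * r x y))"
      by (rule Bochner_Integration.integral_cong) (auto simp: algebra_simps)
    also have "\<dots> = (1/2) * (LINT y|M. f y * r x y) + (1/2) * (LINT y|M. g y * r x y)"
      using sqint_integrable_mult[OF sq(1) assms(1)[OF that]]
        sqint_integrable_mult[OF sq(2) assms(1)[OF that]] by simp
    also have "\<dots> = t x" using assms(2,3) that by (simp add: moment_set_def)
    finally show ?thesis .
  qed
  moreover have "(\<lambda>y. (1/2) * (f y + g y)) \<in> sqint M"
    by (intro sqint_cmult sqint_add sq)
  ultimately show ?thesis by (simp add: moment_set_def)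
qed

lemma moment_set_min_unique:
  assumes r: "\<And>x. x \<in> X \<Longrightarrow> r x \<in> sqint M"
    and f: "f \<in> moment_set M X r t" and g: "g \<in> moment_set M X r t"
    and min: "\<And>h. h \<in> moment_set M X r t \<Longrightarrow> (LINT y|M. (f y)\<^sup>2) \<le> (LINT y|M. (h y)\<^sup>2)"
    and eq: "(LINT y|M. (g y)\<^sup>2) = (LINT y|M. (f y)\<^sup>2)"
  shows "AE y in M. g y = f y"
proof -
  have sq: "f \<in> sqint M" "g \<in> sqint M" using f g by (auto simp: moment_set_def)
  have "(LINT y|M. (g y - f y)\<^sup>2) \<le> 0"
    unfolding sqint_parallelogram[OF sq(2,1)] using min[OF moment_set_midpoint[OF r g f]] eq by simp
  hence "(LINT y|M. (g y - f y)\<^sup>2) = 0"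
    using integral_square_nonneg[of M "\<lambda>y. g y - f y"] by linarith
  hence "AE y in M. (g y - f y)\<^sup>2 = 0"
    using integral_nonneg_eq_0_iff_AE[OF sqint_integrable_square[OF sqint_diff[OF sq(2,1)]]] by simp
  thus ?thesis by simp
qed

text \<open>A minimising sequence is Cauchy by the parallelogram law. Its limit keeps the moment
  equations because inner products are continuous.\<close>

lemma (in prob_space) moment_set_min_exists:
  assumes r: "\<And>x. x \<in> X \<Longrightarrow> r x \<in> sqint M" and ne: "moment_set M X r t \<noteq> {}"
  obtains f where "f \<in> moment_set M X r t"
    "\<And>h. h \<in> moment_set M X r t \<Longrightarrow> (LINT y|M. (f y)\<^sup>2) \<le> (LINT y|M. (h y)\<^sup>2)"
proof -
  define A where "A = moment_set M X r t"
  define m where "m = Inf ((\<lambda>f. LINT y|M. (f y)\<^sup>2) ` A)"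
  have bdd: "bdd_below ((\<lambda>f. LINT y|M. (f y)\<^sup>2) ` A)" by (auto intro!: bdd_belowI[of _ 0])
  have m_le: "m \<le> (LINT y|M. (f y)\<^sup>2)" if "f \<in> A" for f
    unfolding m_def using that bdd by (auto intro: cInf_lower)
  have "\<exists>f. f \<in> A \<and> (LINT y|M. (f y)\<^sup>2) < m + 1 / real (Suc n)" for n
  proof -
    have "m < m + 1 / real (Suc n)" by simp
    thus ?thesis
      unfolding m_def using ne bdd by (subst (asm) cInf_less_iff) (auto simp: A_def)
  qed
  then obtain f where f: "\<And>n. f n \<in> A" "\<And>n. (LINT y|M. (f n y)\<^sup>2) < m + 1 / real (Suc n)"
    by metis
  have sq: "f n \<in> sqint M" for n using f(1) by (auto simp: A_def moment_set_def)
  have "\<exists>N. \<forall>k\<ge>N. \<forall>n\<ge>N. (LINT y|M. (f k y - f n y)\<^sup>2) < \<epsilon>" if "\<epsilon> > 0" for \<epsilon>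
  proof -
    \<comment> \<open>With squared norms below m + d and the midpoint at least m, the parallelogram
      law bounds the squared distance by 4 d; hence the quarter.\<close>
    obtain N where N: "1 / real (Suc N) < \<epsilon> / 4"
      using \<open>\<epsilon> > 0\<close> by (meson nat_approx_posE divide_pos_pos zero_less_numeral)
    have "(LINT y|M. (f k y - f n y)\<^sup>2) < \<epsilon>" if "k \<ge> N" "n \<ge> N" for k n
    proof -
      have le: "1 / real (Suc j) \<le> 1 / real (Suc N)" if "j \<ge> N" for j
        using that by (simp add: frac_le)
      have "m \<le> (LINT y|M. ((1/2) * (f k y + f n y))\<^sup>2)"
        using f(1) unfolding A_def by (intro m_le[unfolded A_def] moment_set_midpoint r)
      thus ?thesis
        unfolding sqint_parallelogram[OF sq sq] using f(2)[of k] f(2)[of n] le[OF that(1)] le[OF that(2)] N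
        by linarith
    qed
    thus ?thesis by blast
  qed
  from L2_complete[OF sq this] obtain g where g: "L2_tendsto M f g" by blast
  hence g_sq: "g \<in> sqint M" by (simp add: L2_tendsto_def)
  have gA: "g \<in> A"
  proof -
    have "(LINT y|M. g y * r x y) = t x" if "x \<in> X" for x
    proof (rule LIMSEQ_unique[OF L2_tendsto_inner[OF g r[OF that]]])
      show "(\<lambda>n. LINT y|M. f n y * r x y) \<longlonglongrightarrow> t x"
        using f(1) that by (simp add: A_def moment_set_def)
    qed
    thus ?thesis using g_sq by (simp add: A_def moment_set_def)
  qed
  \<comment> \<open>Lower semicontinuity of the norm: the squared norm of \<open>f n\<close> is at
    least 2 <f n, g> - |g|^2, whose limit is |g|^2.\<close>
  have "(LINT y|M. (g y)\<^sup>2) \<le> m"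
  proof (rule LIMSEQ_le)
    show "(\<lambda>n. 2 * (LINT y|M. f n y * g y) - (LINT y|M. (g y)\<^sup>2)) \<longlonglongrightarrow> (LINT y|M. (g y)\<^sup>2)"
      using tendsto_diff[OF tendsto_mult[OF tendsto_const[of 2] L2_tendsto_inner[OF g g_sq]]
          tendsto_const[of "LINT y|M. (g y)\<^sup>2"]]
      by (simp add: power2_eq_square)
    show "(\<lambda>n. m + 1 / real (Suc n)) \<longlonglongrightarrow> m"
      using tendsto_add[OF tendsto_const[of m] LIMSEQ_inverse_real_of_nat] by (simp add: inverse_eq_divide)
    have "2 * (LINT y|M. f n y * g y) - (LINT y|M. (g y)\<^sup>2) \<le> m + 1 / real (Suc n)" for n
      using integral_square_nonneg[of M "\<lambda>y. f n y - g y"] f(2)[of n]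
      unfolding integral_square_diff[OF sq g_sq] by linarith
    thus "\<exists>N. \<forall>n\<ge>N. 2 * (LINT y|M. f n y * g y) - (LINT y|M. (g y)\<^sup>2) \<le> m + 1 / real (Suc n)"
      by blast
  qed
  with that gA m_le show thesis unfolding A_def by fastforce
qed

lemma has_sum_metric:
  fixes f :: "'i \<Rightarrow> real"
  shows "(f has_sum s) A \<longleftrightarrow> (\<forall>\<epsilon>>0. \<exists>F. finite F \<and> F \<subseteq> A \<and>
    (\<forall>G. finite G \<and> F \<subseteq> G \<and> G \<subseteq> A \<longrightarrow> dist (sum f G) s < \<epsilon>))"
  by (simp add: has_sum_def tendsto_iff eventually_finite_subsets_at_top)

section \<open>Orthonormal expansions\<close>

locale orthonormal_family = prob_space M for M :: "'a measure" +
  fixes e :: "'i \<Rightarrow> 'a \<Rightarrow> real"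
  assumes e_sqint: "e p \<in> sqint M"
    and e_orthonormal: "(LINT y|M. e p y * e q y) = of_bool (p = q)"
begin

definition psum :: "('i \<Rightarrow> real) \<Rightarrow> 'i set \<Rightarrow> 'a \<Rightarrow> real" where
  "psum a F y = (\<Sum>p\<in>F. a p * e p y)"

text \<open>Shaped like \<open>is_series_estimator\<close>, so the two agree once
  \<open>est_term\<close> is known to be \<open>a p\<close> times a basis function. The
  integrability clause keeps the bound from holding trivially, since the integral of a
  non-integrable function is 0.\<close>

definition expands :: "('i \<Rightarrow> real) \<Rightarrow> ('a \<Rightarrow> real) \<Rightarrow> bool" where
  "expands a g \<longleftrightarrow> g \<in> borel_measurable M \<and>
     (\<forall>\<epsilon>>0. \<exists>F0. finite F0 \<and> (\<forall>F. finite F \<and> F0 \<subseteq> F \<longrightarrow>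
        integrable M (\<lambda>y. (g y - psum a F y)\<^sup>2) \<and> (LINT y|M. (g y - psum a F y)\<^sup>2) < \<epsilon>))"

lemma psum_sqint: "psum a F \<in> sqint M"
  unfolding psum_def[abs_def] by (intro sqint_sum sqint_cmult e_sqint)

lemma inner_psum:
  assumes "f \<in> sqint M"
  shows "(LINT y|M. f y * psum a F y) = (\<Sum>p\<in>F. a p * (LINT y|M. f y * e p y))"
proof -
  have "(LINT y|M. f y * psum a F y) = (LINT y|M. (\<Sum>p\<in>F. a p * (f y * e p y)))"
    by (simp add: psum_def sum_distrib_left algebra_simps)
  also have "\<dots> = (\<Sum>p\<in>F. a p * (LINT y|M. f y * e p y))"
    using sqint_integrable_mult[OF assms e_sqint] by (subst Bochner_Integration.integral_sum) auto
  finally show ?thesis .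
qed

lemma norm_psum:
  assumes "finite F"
  shows "(LINT y|M. (psum a F y)\<^sup>2) = (\<Sum>p\<in>F. (a p)\<^sup>2)"
proof -
  have "(LINT y|M. psum a F y * e p y) = (if p \<in> F then a p else 0)" for p
    using inner_psum[OF e_sqint, of p a F] assms
    by (simp add: mult.commute[of "psum a F _"] e_orthonormal of_bool_def if_distrib cong: if_cong)
  thus ?thesis
    using inner_psum[OF psum_sqint, of a F a F] by (simp add: power2_eq_square)
qed

lemma dist_psum:
  assumes "f \<in> sqint M" "finite F"
  shows "(LINT y|M. (f y - psum a F y)\<^sup>2) =
    (LINT y|M. (f y)\<^sup>2) - 2 * (\<Sum>p\<in>F. a p * (LINT y|M. f y * e p y)) + (\<Sum>p\<in>F. (a p)\<^sup>2)"
  by (simp add: integral_square_diff assms psum_sqint inner_psum norm_psum)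

text \<open>The squared distance from f to a partial sum with its own coefficients is nonnegative.
  Equality can fail, as the family need not be total.\<close>

lemma Bessel:
  assumes "f \<in> sqint M"
  shows "(\<lambda>p. (LINT y|M. f y * e p y)\<^sup>2) summable_on UNIV"
    and "(\<Sum>\<^sub>\<infinity>p. (LINT y|M. f y * e p y)\<^sup>2) \<le> (LINT y|M. (f y)\<^sup>2)"
proof -
  have fin: "(\<Sum>p\<in>F. (LINT y|M. f y * e p y)\<^sup>2) \<le> (LINT y|M. (f y)\<^sup>2)" if "finite F" for F
    using dist_psum[OF assms that, of "\<lambda>p. LINT y|M. f y * e p y"]
      integral_square_nonneg[of M "\<lambda>y. f y - psum (\<lambda>p. LINT y|M. f y * e p y) F y"]
    by (simp add: power2_eq_square)
  show *: "(\<lambda>p. (LINT y|M. f y * e p y)\<^sup>2) summable_on UNIV"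
    using fin by (intro nonneg_bdd_above_summable_on) (auto intro!: bdd_aboveI)
  show "(\<Sum>\<^sub>\<infinity>p. (LINT y|M. f y * e p y)\<^sup>2) \<le> (LINT y|M. (f y)\<^sup>2)"
    using fin by (intro infsum_le_finite_sums[OF *]) auto
qed

lemma expands_sqint:
  assumes "expands a g"
  shows "g \<in> sqint M"
proof -
  obtain F0 where "integrable M (\<lambda>y. (g y - psum a F0 y)\<^sup>2)"
    using assms unfolding expands_def by (metis order_refl zero_less_one)
  hence "(\<lambda>y. g y - psum a F0 y) \<in> sqint M"
    using assms sqint_borel[OF psum_sqint[of a F0]] by (auto simp: sqint_def expands_def)
  from sqint_add[OF this psum_sqint[of a F0]] show ?thesis by simp
qed

text \<open>Cauchy-Schwarz applied to the remainder and h. Taking h to be a basis function recovers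
  the coefficients, h = g gives Parseval, and h a likelihood ratio gives the moment
  equations.\<close>

lemma expands_inner:
  assumes "expands a g" and h: "h \<in> sqint M"
  shows "((\<lambda>p. a p * (LINT y|M. h y * e p y)) has_sum (LINT y|M. g y * h y)) UNIV"
  unfolding has_sum_metric
proof (intro allI impI)
  fix \<epsilon> :: real assume "\<epsilon> > 0"
  \<comment> \<open>The summand 1 keeps the divisor positive when h vanishes almost
    everywhere.\<close>
  define K where "K = (LINT y|M. (h y)\<^sup>2) + 1"
  have "K > 0" using integral_square_nonneg[of M h] unfolding K_def by linarith
  have g: "g \<in> sqint M" using expands_sqint[OF assms(1)] .
  have "\<epsilon>\<^sup>2 / K > 0" using \<open>\<epsilon> > 0\<close> \<open>K > 0\<close> by simp
  from assms(1)[unfolded expands_def, THEN conjunct2, rule_format, OF this]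
  obtain F0 where F0: "finite F0"
    "\<And>F. finite F \<Longrightarrow> F0 \<subseteq> F \<Longrightarrow> (LINT y|M. (g y - psum a F y)\<^sup>2) < \<epsilon>\<^sup>2 / K"
    by blast
  have "dist (\<Sum>p\<in>F. a p * (LINT y|M. h y * e p y)) (LINT y|M. g y * h y) < \<epsilon>"
    if F: "finite F" "F0 \<subseteq> F" for F
  proof -
    have eq: "(LINT y|M. g y * h y) - (\<Sum>p\<in>F. a p * (LINT y|M. h y * e p y))
        = (LINT y|M. (g y - psum a F y) * h y)"
    proof -
      have "(LINT y|M. (g y - psum a F y) * h y) = (LINT y|M. g y * h y - h y * psum a F y)"
        by (rule Bochner_Integration.integral_cong) (auto simp: algebra_simps)
      thus ?thesis
        using sqint_integrable_mult[OF g h] sqint_integrable_mult[OF h psum_sqint[of a F]]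
        by (simp add: inner_psum[OF h])
    qed
    have "((LINT y|M. (g y - psum a F y) * h y))\<^sup>2
        \<le> (LINT y|M. (g y - psum a F y)\<^sup>2) * (LINT y|M. (h y)\<^sup>2)"
      by (intro L2_Cauchy_Schwarz sqint_diff g psum_sqint h)
    also have "\<dots> \<le> (LINT y|M. (g y - psum a F y)\<^sup>2) * K"
      by (rule mult_left_mono) (simp_all add: K_def)
    also have "\<dots> < \<epsilon>\<^sup>2"
      using F0(2)[OF F] \<open>K > 0\<close> by (simp add: field_simps)
    finally have "\<bar>LINT y|M. (g y - psum a F y) * h y\<bar> < \<epsilon>"
      using \<open>\<epsilon> > 0\<close> by - (rule power2_less_imp_less, auto)
    thus ?thesis unfolding dist_real_def using eq by linarith
  qed
  thus "\<exists>F. finite F \<and> F \<subseteq> UNIV \<and> (\<forall>G. finite G \<and> F \<subseteq> G \<and> G \<subseteq> UNIV \<longrightarrow>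
      dist (\<Sum>p\<in>G. a p * (LINT y|M. h y * e p y)) (LINT y|M. g y * h y) < \<epsilon>)"
    using F0(1) by (intro exI[of _ F0]) blast
qed

lemma expands_coeff:
  assumes "expands a g"
  shows "(LINT y|M. g y * e q y) = a q"
proof -
  have "((\<lambda>p. a p * of_bool (q = p)) has_sum a q) UNIV"
    by (rule has_sum_finite_neutralI[of "{q}"]) auto
  with expands_inner[OF assms e_sqint[of q]] show ?thesis
    unfolding e_orthonormal by (rule has_sum_unique)
qed

lemma Parseval:
  assumes "expands a g"
  shows "((\<lambda>p. (a p)\<^sup>2) has_sum (LINT y|M. (g y)\<^sup>2)) UNIV"
  using expands_inner[OF assms expands_sqint[OF assms]]
  by (simp add: expands_coeff[OF assms] power2_eq_square)

text \<open>The Riesz-Fischer construction. The index type carries no order, so finite sets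
  \<open>T n\<close> are chosen whose complement contributes less than 1/(n+1) to the square sum.
  Partial sums over them form a Cauchy sequence, and the same tail bound upgrades convergence along
  \<open>T\<close> to convergence over all finite sets.\<close>

lemma expands_exists:
  assumes "(\<lambda>p. (a p)\<^sup>2) summable_on UNIV"
  shows "\<exists>g. expands a g"
proof -
  have tail: "\<exists>F0. finite F0 \<and> (\<forall>F. finite F \<and> F \<inter> F0 = {} \<longrightarrow> (\<Sum>p\<in>F. (a p)\<^sup>2) < \<epsilon>)"
    if "\<epsilon> > 0" for \<epsilon>
  proof -
    obtain F0 where F0: "finite F0"
      "\<And>G. finite G \<Longrightarrow> F0 \<subseteq> G \<Longrightarrow> dist (\<Sum>p\<in>G. (a p)\<^sup>2) (\<Sum>\<^sub>\<infinity>p. (a p)\<^sup>2) < \<epsilon> / 2"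
      using has_sum_infsum[OF assms, unfolded has_sum_metric, rule_format, of "\<epsilon> / 2"] \<open>\<epsilon> > 0\<close> by auto
    have "(\<Sum>p\<in>F. (a p)\<^sup>2) < \<epsilon>" if "finite F" "F \<inter> F0 = {}" for F
    proof -
      have "(\<Sum>p\<in>F0 \<union> F. (a p)\<^sup>2) = (\<Sum>p\<in>F0. (a p)\<^sup>2) + (\<Sum>p\<in>F. (a p)\<^sup>2)"
        using that F0(1) by (intro sum.union_disjoint) auto
      moreover have "\<bar>(\<Sum>p\<in>F0. (a p)\<^sup>2) - (\<Sum>\<^sub>\<infinity>p. (a p)\<^sup>2)\<bar> < \<epsilon> / 2"
        "\<bar>(\<Sum>p\<in>F0 \<union> F. (a p)\<^sup>2) - (\<Sum>\<^sub>\<infinity>p. (a p)\<^sup>2)\<bar> < \<epsilon> / 2"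
        using F0(2)[of F0] F0(2)[of "F0 \<union> F"] F0(1) that(1) unfolding dist_real_def by auto
      ultimately show ?thesis by linarith
    qed
    thus ?thesis using F0(1) by blast
  qed
  have "\<exists>F0. finite F0 \<and> (\<forall>F. finite F \<and> F \<inter> F0 = {} \<longrightarrow> (\<Sum>p\<in>F. (a p)\<^sup>2) < 1 / real (Suc n))" for n
    by (rule tail) simp
  then obtain T where T: "\<And>n. finite (T n)"
    "\<And>n F. finite F \<Longrightarrow> F \<inter> T n = {} \<Longrightarrow> (\<Sum>p\<in>F. (a p)\<^sup>2) < 1 / real (Suc n)"
    by metis
  have diff: "(LINT y|M. (psum a F y - psum a G y)\<^sup>2) = (\<Sum>p\<in>F - G. (a p)\<^sup>2) + (\<Sum>p\<in>G - F. (a p)\<^sup>2)"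
    if "finite F" "finite G" for F G
  proof -
    \<comment> \<open>The overlap cancels, leaving one partial sum over the symmetric difference
      with signs flipped on G; the signs vanish on squaring.\<close>
    have "psum a F y - psum a G y = psum (\<lambda>p. if p \<in> G then - a p else a p) ((F - G) \<union> (G - F)) y" for y
    proof -
      have "psum (\<lambda>p. if p \<in> G then - a p else a p) ((F - G) \<union> (G - F)) y
          = psum a (F - G) y - psum a (G - F) y"
        unfolding psum_def using that
        by (subst sum.union_disjoint) (auto simp: sum_negf[symmetric] intro!: sum.cong arg_cong2[where f="(+)"])
      moreover have "psum a F y = psum a (F - G) y + psum a (F \<inter> G) y"
        "psum a G y = psum a (G - F) y + psum a (F \<inter> G) y"
        unfolding psum_def using that
        by (subst sum.union_disjoint[symmetric]; auto intro!: sum.cong)+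
      ultimately show ?thesis by simp
    qed
    hence "(LINT y|M. (psum a F y - psum a G y)\<^sup>2)
        = (\<Sum>p\<in>(F - G) \<union> (G - F). (if p \<in> G then - a p else a p)\<^sup>2)"
      using that by (simp add: norm_psum)
    also have "\<dots> = (\<Sum>p\<in>F - G. (a p)\<^sup>2) + (\<Sum>p\<in>G - F. (a p)\<^sup>2)"
      using that by (subst sum.union_disjoint) auto
    finally show ?thesis .
  qed
  have "\<exists>N. \<forall>m\<ge>N. \<forall>n\<ge>N. (LINT y|M. (psum a (T m) y - psum a (T n) y)\<^sup>2) < \<epsilon>"
    if "\<epsilon> > 0" for \<epsilon>
  proof -
    obtain N where N: "1 / real (Suc N) < \<epsilon> / 2"
      using \<open>\<epsilon> > 0\<close> by (meson nat_approx_posE divide_pos_pos zero_less_numeral)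
    have "(LINT y|M. (psum a (T m) y - psum a (T n) y)\<^sup>2) < \<epsilon>" if "m \<ge> N" "n \<ge> N" for m n
    proof -
      have le: "1 / real (Suc j) \<le> 1 / real (Suc N)" if "j \<ge> N" for j
        using that by (simp add: frac_le)
      have "(\<Sum>p\<in>T m - T n. (a p)\<^sup>2) < 1 / real (Suc n)" "(\<Sum>p\<in>T n - T m. (a p)\<^sup>2) < 1 / real (Suc m)"
        using T(1) by (auto intro!: T(2) simp del: of_nat_Suc)
      thus ?thesis
        using N le[OF that(1)] le[OF that(2)] unfolding diff[OF T(1) T(1)] by linarith
    qed
    thus ?thesis by blast
  qed
  from L2_complete[OF psum_sqint this] obtain g where g: "L2_tendsto M (\<lambda>n. psum a (T n)) g"
    by blast
  hence g_sq: "g \<in> sqint M" and lim: "(\<lambda>n. LINT y|M. (psum a (T n) y - g y)\<^sup>2) \<longlonglongrightarrow> 0"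
    by (auto simp: L2_tendsto_def)
  have "\<exists>F0. finite F0 \<and> (\<forall>F. finite F \<and> F0 \<subseteq> F \<longrightarrow>
        integrable M (\<lambda>y. (g y - psum a F y)\<^sup>2) \<and> (LINT y|M. (g y - psum a F y)\<^sup>2) < \<epsilon>)"
    if "\<epsilon> > 0" for \<epsilon>
  proof -
    \<comment> \<open>The quarters come from |u + v|^2 \<le> 2 |u|^2 + 2 |v|^2, where u is the part
      of F beyond \<open>T n\<close> and v the error of \<open>T n\<close>.\<close>
    obtain N where N: "1 / real (Suc N) < \<epsilon> / 4"
      using \<open>\<epsilon> > 0\<close> by (meson nat_approx_posE divide_pos_pos zero_less_numeral)
    obtain N' where N': "\<And>n. n \<ge> N' \<Longrightarrow> (LINT y|M. (psum a (T n) y - g y)\<^sup>2) < \<epsilon> / 4"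
      using LIMSEQ_D[OF lim, of "\<epsilon> / 4"] \<open>\<epsilon> > 0\<close> by auto
    define n where "n = max N N'"
    have n: "1 / real (Suc n) < \<epsilon> / 4" "(LINT y|M. (psum a (T n) y - g y)\<^sup>2) < \<epsilon> / 4"
    proof -
      have "1 / real (Suc n) \<le> 1 / real (Suc N)" by (simp add: frac_le n_def)
      with N show "1 / real (Suc n) < \<epsilon> / 4" by linarith
      show "(LINT y|M. (psum a (T n) y - g y)\<^sup>2) < \<epsilon> / 4"
        by (rule N') (simp add: n_def)
    qed
    have "(LINT y|M. (g y - psum a F y)\<^sup>2) < \<epsilon>" if F: "finite F" "T n \<subseteq> F" for F
    proof -
      define u v where "u y = psum a F y - psum a (T n) y" and "v y = psum a (T n) y - g y" for y
      have uv: "u \<in> sqint M" "v \<in> sqint M"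
        unfolding u_def[abs_def] v_def[abs_def] by (intro sqint_diff psum_sqint g_sq)+
      have "(LINT y|M. (g y - psum a F y)\<^sup>2) = (LINT y|M. (u y + 1 * v y)\<^sup>2)"
        by (simp add: u_def v_def power2_commute)
      also have "\<dots> \<le> 2 * (LINT y|M. (u y)\<^sup>2) + 2 * (LINT y|M. (v y)\<^sup>2)"
        using integral_square_add[OF uv, of 1] integral_square_diff[OF uv]
          integral_square_nonneg[of M "\<lambda>y. u y - v y"] by simp
      also have "(LINT y|M. (u y)\<^sup>2) = (\<Sum>p\<in>F - T n. (a p)\<^sup>2)"
        using diff[OF F(1) T(1)[of n]] F(2) by (simp add: u_def Diff_eq_empty_iff[THEN iffD2])
      also have "\<dots> < 1 / real (Suc n)" using F(1) by (intro T(2)) auto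
      finally show ?thesis using n by (simp add: v_def)
    qed
    thus ?thesis
      using T(1) sqint_integrable_square[OF sqint_diff[OF g_sq psum_sqint]]
      by (intro exI[of _ "T n"]) blast
  qed
  thus ?thesis using sqint_borel[OF g_sq] unfolding expands_def by blast
qed

text \<open>Equality in Bessel's inequality suffices: the squared distance from f to its partial sum
  over F is exactly |f|^2 minus the square sum over F.\<close>

lemma expandsI_Parseval:
  assumes f: "f \<in> sqint M" and r: "\<And>p. (LINT y|M. f y * e p y) = r p"
    and s: "((\<lambda>p. (r p)\<^sup>2) has_sum (LINT y|M. (f y)\<^sup>2)) UNIV"
  shows "expands r f"
  unfolding expands_def
proof (intro conjI allI impI)
  show "f \<in> borel_measurable M" using f by (rule sqint_borel)
  fix \<epsilon> :: real assume "\<epsilon> > 0"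
  then obtain F0 where F0: "finite F0"
    "\<And>G. finite G \<Longrightarrow> F0 \<subseteq> G \<Longrightarrow> dist (\<Sum>p\<in>G. (r p)\<^sup>2) (LINT y|M. (f y)\<^sup>2) < \<epsilon>"
    using s[unfolded has_sum_metric, rule_format, of \<epsilon>] by auto
  have "(LINT y|M. (f y - psum r F y)\<^sup>2) < \<epsilon>" if "finite F" "F0 \<subseteq> F" for F
    using F0(2)[OF that] unfolding dist_psum[OF f that(1)] r
    by (simp add: dist_real_def power2_eq_square)
  thus "\<exists>F0. finite F0 \<and> (\<forall>F. finite F \<and> F0 \<subseteq> F \<longrightarrow>
        integrable M (\<lambda>y. (f y - psum r F y)\<^sup>2) \<and> (LINT y|M. (f y - psum r F y)\<^sup>2) < \<epsilon>)"
    using F0(1) sqint_integrable_square[OF sqint_diff[OF f psum_sqint]] by blast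
qed

end

section \<open>Hermite polynomials\<close>

text \<open>The probabilists' polynomials, orthogonal for the weight exp(- x^2 / 2). This recursion,
  rather than the three-term one, fits both Gaussian integration by parts and differentiation of the
  generating function.\<close>

fun hermite :: "nat \<Rightarrow> real poly" where
  "hermite 0 = 1"
| "hermite (Suc n) = [:0, 1:] * hermite n - pderiv (hermite n)"

text \<open>Differentiating the recursion and inserting the induction hypothesis reproduces the
  recursion one degree lower. This lowers the first index in the orthogonality induction.\<close>

lemma pderiv_hermite: "pderiv (hermite (Suc n)) = smult (real (Suc n)) (hermite n)"
proof (induction n)
  case (Suc n)
  have "pderiv (hermite (Suc (Suc n)))
      = hermite (Suc n) + [:0, 1:] * pderiv (hermite (Suc n)) - pderiv (pderiv (hermite (Suc n)))"
    by (simp only: hermite.simps(2)[of "Suc n"] pderiv_diff pderiv_mult)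
      (simp add: pderiv_pCons del: hermite.simps)
  also have "\<dots> = hermite (Suc n) + smult (real (Suc n)) ([:0, 1:] * hermite n - pderiv (hermite n))"
    by (simp only: Suc.IH pderiv_smult mult_smult_right smult_diff_right add_diff_eq)
  also have "\<dots> = smult (real (Suc (Suc n))) (hermite (Suc n))"
    by (simp only: hermite.simps(2)[symmetric] of_nat_Suc[of "Suc n"] smult_add_left smult_1_left)
  finally show ?case .
qed (simp add: pderiv_pCons)

text \<open>The product rule gives the factor (w - t) He_n(w - t) - He_n'(w - t), which is the
  recursion at w - t. Hence repeated differentiation of the generating function stays within one
  family.\<close>

lemma DERIV_hermite_exp:
  "((\<lambda>t. poly (hermite n) (w - t) * exp (w * t - t\<^sup>2 / 2)) has_real_derivative
     poly (hermite (Suc n)) (w - t) * exp (w * t - t\<^sup>2 / 2)) (at t)"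
  by (rule derivative_eq_intros poly_DERIV refl DERIV_chain2[where f = "poly _"] | simp)+
    (simp add: algebra_simps)

section \<open>Polynomial moments of the standard normal law and integration by parts\<close>

definition gauss_E :: "(real \<Rightarrow> real) \<Rightarrow> real" where
  "gauss_E f = (LINT x|lborel. std_normal_density x * f x)"

lemma integrable_gauss_poly: "integrable lborel (\<lambda>x. std_normal_density x * poly q x)"
proof -
  have "integrable lborel (\<lambda>x. \<Sum>i\<le>degree q. coeff q i * (std_normal_density x * x ^ i))"
    by (intro Bochner_Integration.integrable_sum integrable_mult_right integrable_std_normal_moment)
  thus ?thesis
    by (simp add: poly_altdef sum_distrib_left algebra_simps)
qed

text \<open>Read off from the closed forms: odd moments vanish and the moment of order 2k is (2k)! /
  (2^k k!). For n = 0 the truncated \<open>n - 1\<close> is harmless, since the factor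
  \<open>real n\<close> is 0.\<close>

lemma gauss_E_moment_Suc: "gauss_E (\<lambda>x. x ^ Suc n) = real n * gauss_E (\<lambda>x. x ^ (n - 1))"
proof (cases "even n")
  case True
  then obtain k where k: "n = 2 * k" by (elim evenE)
  have "gauss_E (\<lambda>x. x ^ Suc n) = 0"
    using integral_std_normal_moment_odd[of k] by (simp add: gauss_E_def k)
  moreover have "real n * gauss_E (\<lambda>x. x ^ (n - 1)) = 0"
  proof (cases k)
    case (Suc j)
    thus ?thesis using integral_std_normal_moment_odd[of j] by (simp add: gauss_E_def k)
  qed (simp add: k)
  ultimately show ?thesis by simp
next
  case False
  then obtain k where k: "n = 2 * k + 1" by (elim oddE)
  have "gauss_E (\<lambda>x. x ^ Suc n) = fact (2 * Suc k) / (2 ^ Suc k * fact (Suc k))"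
    using integral_std_normal_moment_even[of "Suc k"] by (simp add: gauss_E_def k)
  also have "\<dots> = real n * (fact (2 * k) / (2 ^ k * fact k))"
    by (simp add: k divide_simps)
  also have "fact (2 * k) / (2 ^ k * fact k) = gauss_E (\<lambda>x. x ^ (n - 1))"
    using integral_std_normal_moment_even[of "k"] by (simp add: gauss_E_def k)
  finally show ?thesis .
qed

lemma gauss_E_poly_add: "gauss_E (poly (p + q)) = gauss_E (poly p) + gauss_E (poly q)"
  using integrable_gauss_poly[of p] integrable_gauss_poly[of q]
  by (simp add: gauss_E_def distrib_left)

lemma gauss_E_poly_smult: "gauss_E (poly (smult c p)) = c * gauss_E (poly p)"
  by (simp add: gauss_E_def mult.left_commute[of _ c])

lemma gauss_E_poly_diff: "gauss_E (poly (p - q)) = gauss_E (poly p) - gauss_E (poly q)"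
  using gauss_E_poly_add[of p "smult (-1) q"] gauss_E_poly_smult[of "-1" q] by simp

text \<open>Both sides are linear in q, and on monomials the identity is the moment
  recursion.\<close>

lemma Stein_identity: "gauss_E (poly ([:0, 1:] * q)) = gauss_E (poly (pderiv q))"
proof -
  have mono: "gauss_E (poly ([:0, 1:] * monom c n)) = gauss_E (poly (pderiv (monom c n)))" for c n
  proof -
    have "[:0, 1:] * monom c n = monom c (Suc n)" by (simp add: monom_Suc)
    moreover have "gauss_E (poly (monom c k)) = c * gauss_E (\<lambda>x. x ^ k)" for c k
      by (simp add: gauss_E_def poly_monom mult.left_commute[of _ c])
    ultimately show ?thesis
      by (simp only: pderiv_monom gauss_E_moment_Suc) simp
  qed
  have sum: "gauss_E (poly ([:0, 1:] * (\<Sum>i\<in>A. monom (coeff q i) i)))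
      = gauss_E (poly (pderiv (\<Sum>i\<in>A. monom (coeff q i) i)))" if "finite A" for A
    using that
  proof induction
    case (insert i A)
    thus ?case
      using mono[of "coeff q i" i]
      by (metis (no_types, lifting) distrib_left gauss_E_poly_add pderiv_add sum.insert)
  qed simp
  show ?thesis
    using sum[of "{..degree q}"] by (simp add: poly_as_sum_of_monoms)
qed

lemma gauss_E_one: "gauss_E (poly 1) = 1"
  by (simp add: gauss_E_def)

text \<open>In the shifted recursion (x + z) h - h' the terms x h and h' have equal expectation by
  Stein's identity, so each step leaves one factor z.\<close>

lemma gauss_E_hermite_shift: "gauss_E (poly (pcompose (hermite n) [:z, 1:])) = z ^ n"
proof (induction n)
  case (Suc n)
  let ?h = "pcompose (hermite n) [:z, 1:]"
  have "pcompose (hermite (Suc n)) [:z, 1:] = ([:0, 1:] * ?h + smult z ?h) - pderiv ?h"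
    by (simp add: pcompose_diff pcompose_mult pcompose_pCons pderiv_pcompose pderiv_pCons)
  thus ?case
    by (simp only: gauss_E_poly_diff gauss_E_poly_add gauss_E_poly_smult Stein_identity Suc) simp
qed (simp add: gauss_E_one pcompose_1 del: poly_1)

text \<open>Stein's identity moves the derivative to the other factor: the expectation of He_m
  He_(n+1) is that of He_m' He_n, and He_m' is m He_(m-1). Both indices drop by one.\<close>

lemma gauss_E_hermite_mult:
  "gauss_E (poly (hermite m * hermite n)) = fact n * of_bool (m = n)"
proof (induction n arbitrary: m)
  case 0
  \<comment> \<open>The shift by z = 0 gives 0 ^ m, which is 1 exactly for m = 0.\<close>
  show ?case
    using gauss_E_hermite_shift[of m 0] by (simp add: pcompose_idR)
next
  case (Suc n)
  have "hermite m * hermite (Suc n)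
      = ([:0, 1:] * (hermite m * hermite n) - pderiv (hermite m * hermite n)) + pderiv (hermite m) * hermite n"
    by (simp add: pderiv_mult algebra_simps)
  hence *: "gauss_E (poly (hermite m * hermite (Suc n))) = gauss_E (poly (pderiv (hermite m) * hermite n))"
    by (simp only: gauss_E_poly_diff gauss_E_poly_add Stein_identity)
  show ?case
  proof (cases m)
    case 0
    thus ?thesis using * by (simp add: gauss_E_def del: hermite.simps(2))
  next
    case (Suc k)
    show ?thesis
      using * unfolding Suc pderiv_hermite mult_smult_left gauss_E_poly_smult Suc.IH
      by (simp add: of_bool_def del: hermite.simps poly_mult)
  qed
qed

section \<open>Exponential tilting and the Hermite generating function\<close>

lemma gauss_tilt: "std_normal_density x * exp (a * x) = exp (a\<^sup>2 / 2) * std_normal_density (x - a)"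
  by (simp add: normal_density_def exp_add[symmetric] power2_eq_square field_simps)

lemma has_bochner_integral_gauss_shift:
  assumes "integrable lborel (\<lambda>x. std_normal_density x * f (a + x))"
  shows "has_bochner_integral lborel (\<lambda>x. std_normal_density x * (exp (a * x) * f x))
    (exp (a\<^sup>2 / 2) * gauss_E (\<lambda>x. f (a + x)))"
proof -
  have "has_bochner_integral lborel (\<lambda>x. std_normal_density (a + 1 * x - a) * f (a + 1 * x))
      (gauss_E (\<lambda>x. f (a + x)) /\<^sub>R \<bar>1\<bar>)"
    using assms by (simp add: gauss_E_def has_bochner_integral_iff)
  hence "has_bochner_integral lborel (\<lambda>x. std_normal_density (x - a) * f x) (gauss_E (\<lambda>x. f (a + x)))"
    by (subst lborel_has_bochner_integral_real_affine_iff[of 1 _ _ a]) auto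
  from has_bochner_integral_mult_right[OF this, of "exp (a\<^sup>2 / 2)"] show ?thesis
    by (simp add: mult.assoc[symmetric] gauss_tilt)
qed

text \<open>The generating function, the sum of z^n He_n(x) / n!. It is also the likelihood ratio of
  N(z, 1) against N(0, 1), which is how likelihood ratios meet Hermite polynomials.\<close>

definition gen :: "real \<Rightarrow> real \<Rightarrow> real" where
  "gen z x = exp (z * x - z\<^sup>2 / 2)"

lemma gen_eq: "gen z x = exp (- (z\<^sup>2 / 2)) * exp (z * x)"
  by (simp add: gen_def exp_add[symmetric])

text \<open>With the next two lemmas, the one-dimensional inner products from which all the later
  ones are multiplied together. \<open>has_bochner_integral\<close> carries integrability and value
  through products at once.\<close>

lemma gauss_hermite_hermite:
  "has_bochner_integral lborel (\<lambda>x. std_normal_density x * (poly (hermite m) x * poly (hermite n) x))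
    (fact n * of_bool (m = n))"
  using integrable_gauss_poly[of "hermite m * hermite n"] gauss_E_hermite_mult[of m n]
  by (simp add: gauss_E_def has_bochner_integral_iff del: hermite.simps)

lemma gauss_gen_hermite:
  "has_bochner_integral lborel (\<lambda>x. std_normal_density x * (gen z x * poly (hermite n) x)) (z ^ n)"
proof -
  have *: "poly (hermite n) (z + x) = poly (pcompose (hermite n) [:z, 1:]) x" for x
    by (simp add: poly_pcompose)
  have "has_bochner_integral lborel (\<lambda>x. std_normal_density x * (exp (z * x) * poly (hermite n) x))
     (exp (z\<^sup>2 / 2) * z ^ n)"
    using has_bochner_integral_gauss_shift[of "poly (hermite n)" z]
    unfolding * using integrable_gauss_poly gauss_E_hermite_shift[of n z] by simp
  from has_bochner_integral_mult_right[OF this, of "exp (- (z\<^sup>2 / 2))"]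
  have "has_bochner_integral lborel
      (\<lambda>x. exp (- (z\<^sup>2 / 2)) * (std_normal_density x * (exp (z * x) * poly (hermite n) x)))
      (exp (- (z\<^sup>2 / 2)) * (exp (z\<^sup>2 / 2) * z ^ n))" .
  moreover have "exp (- (z\<^sup>2 / 2)) * (std_normal_density x * (exp (z * x) * poly (hermite n) x))
      = std_normal_density x * (gen z x * poly (hermite n) x)" for x
    by (simp add: gen_eq)
  moreover have "exp (- (z\<^sup>2 / 2)) * (exp (z\<^sup>2 / 2) * z ^ n) = z ^ n"
    by (simp add: exp_minus)
  ultimately show ?thesis by simp
qed

lemma gauss_gen_gen:
  "has_bochner_integral lborel (\<lambda>x. std_normal_density x * (gen z x * gen z x)) (exp (z\<^sup>2))"
proof -
  have eq: "std_normal_density x * (gen z x * gen z x)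
      = exp (- (z\<^sup>2)) * (std_normal_density x * (exp ((2 * z) * x) * 1))" for x
    by (simp add: gen_def exp_add[symmetric] algebra_simps)
  have "has_bochner_integral lborel (\<lambda>x. std_normal_density x * (exp ((2 * z) * x) * 1))
      (exp ((2 * z)\<^sup>2 / 2) * gauss_E (\<lambda>x. 1))"
    by (rule has_bochner_integral_gauss_shift) simp
  from has_bochner_integral_mult_right[OF this, of "exp (- (z\<^sup>2))"] show ?thesis
    by (simp only: eq gauss_E_def) (simp add: exp_add[symmetric] power2_eq_square field_simps)
qed

section \<open>Rotation invariance of Lebesgue measure\<close>

lemma nn_integral_lborel_translate:
  fixes f :: "'a::euclidean_space \<Rightarrow> ennreal"
  assumes [measurable]: "f \<in> borel_measurable borel"
  shows "(\<integral>\<^sup>+x. f (t + x) \<partial>lborel) = (\<integral>\<^sup>+x. f x \<partial>lborel)"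
proof -
  have "(\<integral>\<^sup>+x. f x \<partial>lborel) = (\<integral>\<^sup>+x. f x \<partial>distr lborel borel ((+) t))"
    by (simp add: lborel_distr_plus)
  also have "\<dots> = (\<integral>\<^sup>+x. f (t + x) \<partial>lborel)"
    by (subst nn_integral_distr) auto
  finally show ?thesis ..
qed

text \<open>Uniqueness of translation-invariant measures, with the unit ball as the test function:
  both sides are multiplied by the volume of the ball, which Q leaves unchanged.\<close>
lemma nn_integral_lborel_orthogonal:
  fixes f :: "'a::euclidean_space \<Rightarrow> ennreal" and Q :: "'a \<Rightarrow> 'a"
  assumes f[measurable]: "f \<in> borel_measurable borel" and Q: "orthogonal_transformation Q"
  shows "(\<integral>\<^sup>+x. f (Q x) \<partial>lborel) = (\<integral>\<^sup>+x. f x \<partial>lborel)"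
proof -
  have lin: "linear Q" using Q by (rule orthogonal_transformation_linear)
  have Qm[measurable]: "Q \<in> borel_measurable borel"
    by (intro borel_measurable_continuous_onI linear_continuous_on linear_linear[THEN iffD2] lin)
  define B :: "'a \<Rightarrow> ennreal" where "B = indicator (ball 0 1)"
  have Bm[measurable]: "B \<in> borel_measurable borel" by (simp add: B_def borel_measurable_indicator)
  define G where "G = (\<integral>\<^sup>+x. B x \<partial>lborel)"
  have B_minus: "B (- Q x) = B x" for x
    using Q by (simp add: B_def indicator_def orthogonal_transformation_norm)
  have G: "G \<noteq> 0" "G \<noteq> \<infinity>"
  proof -
    have "measure lborel (ball (0::'a) 1) > 0" by (simp add: content_ball_pos)
    moreover have "emeasure lborel (ball (0::'a) 1) < \<infinity>" by (rule emeasure_lborel_ball_finite)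
    moreover have "G = emeasure lborel (ball (0::'a) 1)" by (simp add: G_def B_def)
    ultimately show "G \<noteq> 0" "G \<noteq> \<infinity>" by (auto simp: measure_def)
  qed
  have "(\<integral>\<^sup>+x. f (Q x) \<partial>lborel) * G = (\<integral>\<^sup>+x. \<integral>\<^sup>+y. f (Q x) * B y \<partial>lborel \<partial>lborel)"
    by (simp add: G_def nn_integral_cmult nn_integral_multc)
  also have "\<dots> = (\<integral>\<^sup>+x. \<integral>\<^sup>+y. f (Q x) * B (- Q x + y) \<partial>lborel \<partial>lborel)"
    by (simp add: nn_integral_cmult nn_integral_lborel_translate del: uminus_add_conv_diff)
  also have "\<dots> = (\<integral>\<^sup>+y. \<integral>\<^sup>+x. f (Q x) * B (- Q x + y) \<partial>lborel \<partial>lborel)"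
    by (rule lborel_pair.Fubini') measurable
  also have "\<dots> = (\<integral>\<^sup>+y. \<integral>\<^sup>+x. f (Q x + y) * B x \<partial>lborel \<partial>lborel)"
  proof (rule nn_integral_cong)
    fix y
    \<comment> \<open>Translating x by a preimage of y moves the shift from the ball to f; what
      remains in the ball is - Q x.\<close>
    obtain t where t: "Q t = y"
      using orthogonal_transformation_surj[OF Q] by (metis surjD)
    have "(\<integral>\<^sup>+x. f (Q x) * B (- Q x + y) \<partial>lborel)
        = (\<integral>\<^sup>+x. f (Q (t + x)) * B (- Q (t + x) + y) \<partial>lborel)"
      by (rule nn_integral_lborel_translate[symmetric]) measurable
    also have "\<dots> = (\<integral>\<^sup>+x. f (Q x + y) * B x \<partial>lborel)"
      by (simp add: linear_add[OF lin] t B_minus add.commute)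
    finally show "(\<integral>\<^sup>+x. f (Q x) * B (- Q x + y) \<partial>lborel) = (\<integral>\<^sup>+x. f (Q x + y) * B x \<partial>lborel)" .
  qed
  also have "\<dots> = (\<integral>\<^sup>+x. \<integral>\<^sup>+y. f (Q x + y) * B x \<partial>lborel \<partial>lborel)"
    by (rule lborel_pair.Fubini') measurable
  also have "\<dots> = (\<integral>\<^sup>+x. f x \<partial>lborel) * G"
    by (simp add: G_def nn_integral_cmult nn_integral_multc nn_integral_lborel_translate)
  finally have "(\<integral>\<^sup>+x. f (Q x) \<partial>lborel) * G = (\<integral>\<^sup>+x. f x \<partial>lborel) * G" .
  thus ?thesis using G by (metis ennreal_mult_divide_eq infinity_ennreal_def)
qed

lemma lborel_distr_orthogonal:
  fixes Q :: "'a::euclidean_space \<Rightarrow> 'a"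
  assumes Q: "orthogonal_transformation Q"
  shows "distr lborel borel Q = lborel"
proof (rule measure_eqI)
  have [measurable]: "Q \<in> borel_measurable borel"
    by (intro borel_measurable_continuous_onI linear_continuous_on linear_linear[THEN iffD2]
        orthogonal_transformation_linear Q)
  fix A assume "A \<in> sets (distr lborel borel Q)"
  hence [measurable]: "A \<in> sets borel" by simp
  have "emeasure (distr lborel borel Q) A = (\<integral>\<^sup>+x. indicator A (Q x) \<partial>lborel)"
    by (subst nn_integral_distr[of Q lborel borel "indicator A", symmetric]) auto
  also have "\<dots> = (\<integral>\<^sup>+x. indicator A x \<partial>lborel)"
    by (rule nn_integral_lborel_orthogonal[OF _ Q]) simp
  finally show "emeasure (distr lborel borel Q) A = emeasure lborel A" by simp
qed simp

text \<open>An orthogonal extension that spans the space has \<open>CARD('m)\<close> elements, so it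
  can be indexed by \<open>'m\<close> itself; \<open>\<iota>\<close> records where the given vectors
  end up. Normalising by \<open>sgn\<close> leaves these unit vectors unchanged.\<close>

lemma orthonormal_extend:
  fixes u :: "'d::finite \<Rightarrow> real^'m"
  assumes u: "\<And>i j. u i \<bullet> u j = of_bool (i = j)"
  obtains v :: "'m \<Rightarrow> real^'m" and \<iota> :: "'d \<Rightarrow> 'm"
  where "inj \<iota>" "\<And>i j. v i \<bullet> v j = of_bool (i = j)" "\<And>j. v (\<iota> j) = u j"
proof -
  have inj_u: "inj u"
    by (rule injI) (metis of_bool_eq_1_iff u)
  have nu: "norm (u i) = 1" for i by (simp add: norm_eq_1 u)
  have orth_u: "pairwise orthogonal (range u)"
    by (auto simp: pairwise_def orthogonal_def u)
  obtain W where W: "W \<inter> insert 0 (range u) = {}" "pairwise orthogonal (range u \<union> W)"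
    "span (range u \<union> W) = span (range u \<union> UNIV)"
    using orthogonal_extension_strong[OF orth_u] by metis
  define C where "C = range u \<union> W"
  have C0: "0 \<notin> C" using W(1) nu by (auto simp: C_def) (metis norm_zero zero_neq_one)
  have ind: "independent C"
    using pairwise_orthogonal_independent[of C] W(2) C0 by (simp add: C_def)
  hence "finite C" by (rule independent_imp_finite)
  have "card C = dim (UNIV :: (real^'m) set)"
    using ind W(3) by (intro basis_card_eq_dim) (auto simp: C_def)
  hence "card C = CARD('m)" by simp
  then obtain h where h: "bij_betw h C (UNIV :: 'm set)"
    using finite_same_card_bij[of C "UNIV :: 'm set"] \<open>finite C\<close> by auto
  define k where "k = inv_into C h"
  have k: "bij_betw k UNIV C" unfolding k_def by (rule bij_betw_inv_into[OF h])
  have kC: "k i \<in> C" for i using k by (auto simp: bij_betw_def)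
  have kinj: "k i = k j \<longleftrightarrow> i = j" for i j using k by (auto simp: bij_betw_def inj_def)
  show thesis
  proof
    show "inj (\<lambda>j. h (u j))"
      using h inj_u by (auto simp: inj_def bij_betw_def C_def dest!: inj_onD)
    show "sgn (k i) \<bullet> sgn (k j) = of_bool (i = j)" for i j
    proof (cases "i = j")
      case True
      have "k i \<noteq> 0" using kC[of i] C0 by auto
      thus ?thesis using True by (simp add: norm_sgn power2_norm_eq_inner[symmetric])
    next
      case False
      hence "orthogonal (k i) (k j)"
        using W(2) kC kinj unfolding C_def[symmetric] pairwise_def by blast
      thus ?thesis using False by (simp add: sgn_div_norm orthogonal_def)
    qed
    show "sgn (k (h (u j))) = u j" for j
    proof -
      have "k (h (u j)) = u j"
        unfolding k_def using h by (intro inv_into_f_f) (auto simp: bij_betw_def C_def)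
      thus ?thesis by (simp add: sgn_div_norm nu)
    qed
  qed
qed

text \<open>Fubini for products of one-variable functions. The product measure behind
  \<open>lborel\<close> is indexed by \<open>Basis\<close>, so the work is reindexing from
  \<open>'m\<close> to axis vectors.\<close>

lemma has_bochner_integral_lborel_prod:
  fixes f :: "'m::finite \<Rightarrow> real \<Rightarrow> real"
  assumes "\<And>i. has_bochner_integral lborel (f i) (s i)"
  shows "has_bochner_integral lborel (\<lambda>y::real^'m. \<Prod>i\<in>UNIV. f i (y $ i)) (\<Prod>i\<in>UNIV. s i)"
proof -
  interpret product_sigma_finite "\<lambda>_::real^'m. lborel :: real measure" by standard
  \<comment> \<open>Recovers the coordinate from its basis vector; the choice is unique since
    distinct axes differ.\<close>
  define F where "F b = f (SOME i. b = axis i 1)" for b :: "real^'m"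
  have F: "F (axis i 1) = f i" for i
    by (simp add: F_def axis_eq_axis)
  have basis: "Basis = range (\<lambda>i::'m. axis i (1::real))"
    by (auto simp: Basis_vec_def)
  have inj: "inj (\<lambda>i::'m. axis i (1::real))" by (auto simp: inj_def axis_eq_axis)
  have prod: "(\<Prod>b\<in>Basis. G b) = (\<Prod>i\<in>UNIV. G (axis i 1))" for G :: "real^'m \<Rightarrow> real"
    unfolding basis by (subst prod.reindex[OF inj]) simp
  have fi: "integrable lborel (f i)" "integral\<^sup>L lborel (f i) = s i" for i
    using assms by (auto simp: has_bochner_integral_iff)
  have Fi: "integrable lborel (F b)" if "b \<in> Basis" for b
    using that by (auto simp: basis F fi)
  have comp: "(\<Sum>b\<in>Basis. x b *\<^sub>R b) $ i = x (axis i 1)" for x :: "real^'m \<Rightarrow> real" and i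
    using inner_sum_left_Basis[of "axis i 1" x] by (simp add: inner_axis basis)
  have meas[measurable]: "f i \<in> borel_measurable borel" for i
    using borel_measurable_integrable[OF fi(1)] by simp
  have eq: "(\<Prod>i\<in>UNIV. f i ((\<Sum>b\<in>Basis. x b *\<^sub>R b) $ i)) = (\<Prod>b\<in>Basis. F b (x b))" for x
    by (simp only: prod comp F)
  have *: "(LINT x|(\<Pi>\<^sub>M b\<in>Basis. lborel). (\<Prod>b\<in>Basis. F b (x b))) = (\<Prod>i\<in>UNIV. s i)"
    by (subst product_integral_prod) (auto simp: prod F fi intro: Fi)
  show ?thesis
    unfolding has_bochner_integral_iff lborel_eq[where 'a = "real^'m"]
  proof (intro conjI)
    show "integrable (distr (\<Pi>\<^sub>M b\<in>Basis. lborel) borel (\<lambda>f. \<Sum>b\<in>Basis. f b *\<^sub>R b))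
       (\<lambda>y::real^'m. \<Prod>i\<in>UNIV. f i (y $ i))"
      by (subst integrable_distr_eq) (auto simp: eq intro!: product_integrable_prod Fi simp del: sum_component)
    show "(LINT y|distr (\<Pi>\<^sub>M b\<in>Basis. lborel) borel (\<lambda>f. \<Sum>b\<in>Basis. f b *\<^sub>R b).
       (\<Prod>i\<in>UNIV. f i ((y::real^'m) $ i))) = (\<Prod>i\<in>UNIV. s i)"
      by (subst integral_distr) (auto simp: eq *[symmetric] simp del: sum_component)
  qed
qed

section \<open>The whitened Gaussian model\<close>

definition gdens :: "real \<Rightarrow> real^'m \<Rightarrow> real^'m \<Rightarrow> real" where
  "gdens \<sigma> \<theta> y = (\<Prod>i\<in>UNIV. normal_density (\<theta> $ i) \<sigma> (y $ i))"

definition gauss :: "real \<Rightarrow> real^'m \<Rightarrow> (real^'m) measure" where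
  "gauss \<sigma> \<theta> = density lborel (\<lambda>y. ennreal (gdens \<sigma> \<theta> y))"

lemma obs_eq_gauss: "obs \<sigma> H x = gauss \<sigma> (H *v x)"
  by (simp add: obs_def gauss_def gdens_def)

lemma gdens_measurable[measurable]: "gdens \<sigma> \<theta> \<in> borel_measurable borel"
  unfolding gdens_def[abs_def] by measurable

lemma sets_gauss[measurable_cong]: "sets (gauss \<sigma> \<theta>) = sets borel"
  by (simp add: gauss_def)

lemma gdens_nonneg: "0 \<le> gdens \<sigma> \<theta> y"
  by (simp add: gdens_def prod_nonneg)

text \<open>In this form the density depends on y only through |y - \<theta>|, so rotations about
  the mean preserve it and squares can be completed in the exponent.\<close>

lemma gdens_altdef:
  fixes \<theta> :: "real^'m"
  shows "gdens \<sigma> \<theta> y = (1 / sqrt (2 * pi * \<sigma>\<^sup>2)) ^ CARD('m) * exp (- (norm (y - \<theta>))\<^sup>2 / (2 * \<sigma>\<^sup>2))"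
proof -
  have "gdens \<sigma> \<theta> y = (\<Prod>i\<in>UNIV. (1 / sqrt (2 * pi * \<sigma>\<^sup>2)) * exp (- (y $ i - \<theta> $ i)\<^sup>2 / (2 * \<sigma>\<^sup>2)))"
    by (simp add: gdens_def normal_density_def)
  also have "\<dots> = (1 / sqrt (2 * pi * \<sigma>\<^sup>2)) ^ CARD('m)
      * (\<Prod>i\<in>UNIV. exp (- (y $ i - \<theta> $ i)\<^sup>2 / (2 * \<sigma>\<^sup>2)))"
    by (subst prod.distrib) simp
  also have "(\<Prod>i\<in>UNIV. exp (- (y $ i - \<theta> $ i)\<^sup>2 / (2 * \<sigma>\<^sup>2)))
      = exp (- (\<Sum>i\<in>UNIV. (y $ i - \<theta> $ i)\<^sup>2) / (2 * \<sigma>\<^sup>2))"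
    by (simp add: exp_sum[symmetric] sum_negf sum_divide_distrib)
  also have "(\<Sum>i\<in>UNIV. (y $ i - \<theta> $ i)\<^sup>2) = (norm (y - \<theta>))\<^sup>2"
    unfolding power2_norm_eq_inner inner_vec_def by (simp add: power2_eq_square)
  finally show ?thesis .
qed

lemma prob_space_gauss:
  assumes "\<sigma> > 0"
  shows "prob_space (gauss \<sigma> \<theta>)"
proof
  have "has_bochner_integral lborel (gdens \<sigma> \<theta>) (\<Prod>i\<in>(UNIV::'a set). 1)"
    unfolding gdens_def[abs_def]
    by (rule has_bochner_integral_lborel_prod)
      (simp add: has_bochner_integral_iff integrable_normal_density integral_normal_density assms)
  hence "(\<integral>\<^sup>+y. ennreal (gdens \<sigma> \<theta> y) \<partial>lborel) = 1"
    by (simp add: has_bochner_integral_iff nn_integral_eq_integral gdens_nonneg)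
  thus "emeasure (gauss \<sigma> \<theta>) (space (gauss \<sigma> \<theta>)) = 1"
    by (simp add: gauss_def emeasure_density)
qed

lemma mfact_pos: "mfact p > 0"
  by (simp add: mfact_def prod_pos)

lemma poly_borel[measurable]: "poly (q :: real poly) \<in> borel_measurable borel"
  by (intro borel_measurable_continuous_onI continuous_on_poly continuous_on_id)

lemma gen_borel[measurable]: "gen z \<in> borel_measurable borel"
  unfolding gen_def[abs_def] by measurable

text \<open>Absolute summability lets the product of the one-dimensional exponential series be
  multiplied out into one unordered sum over multi-indices. It evaluates the square sum of the
  coefficients of a likelihood ratio.\<close>

lemma infsum_multi_exp:
  fixes t :: "'d::finite \<Rightarrow> real"
  shows "(\<Sum>\<^sub>\<infinity>p. \<Prod>j\<in>UNIV. t j ^ p j / fact (p j)) = (\<Prod>j\<in>UNIV. exp (t j))"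
proof -
  have abs: "(\<lambda>n. norm (t ^ n / fact n)) summable_on UNIV" for t :: real
    using summable_norm_exp[of t]
    by (subst summable_on_UNIV_nonneg_real_iff) (auto simp: divide_inverse mult.commute)
  have "((\<lambda>n. t ^ n / fact n) has_sum exp t) UNIV" for t :: real
    using exp_converges[of t] abs[of t] summable_norm_exp[of t]
    by (intro norm_summable_imp_has_sum) (auto simp: divide_inverse mult.commute)
  hence e: "(\<Sum>\<^sub>\<infinity>n. t ^ n / fact n) = exp t" for t :: real by (rule infsumI)
  have "(\<Sum>\<^sub>\<infinity>p\<in>PiE UNIV (\<lambda>_. UNIV). \<Prod>j\<in>UNIV. t j ^ p j / fact (p j))
      = (\<Prod>j\<in>UNIV. \<Sum>\<^sub>\<infinity>n. t j ^ n / fact n)"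
    by (rule infsum_prod_PiE_abs) (use abs in auto)
  thus ?thesis by (simp add: e PiE_UNIV_domain)
qed

text \<open>What the model becomes after the change of parameter z = pinv(Ht) x / \<sigma>: the mean
  H x is \<sigma> U z, and \<open>\<mu>\<close> stands for H x0.\<close>

locale whitened_model =
  fixes \<sigma> :: real and U :: "real^'d::finite^'m" and \<mu> :: "real^'m"
  assumes \<sigma>_pos: "\<sigma> > 0" and U_orthonormal: "transpose U ** U = mat 1"
begin

definition white :: "real^'m \<Rightarrow> 'd \<Rightarrow> real" where
  "white y j = ((y + \<mu>) \<bullet> column j U) / \<sigma>"

text \<open>The common shape of the Hermite functions and, up to a constant factor, of the
  likelihood ratios, so that their inner products split into one-dimensional Gaussian
  integrals.\<close>

definition fac :: "('d \<Rightarrow> real \<Rightarrow> real) \<Rightarrow> real^'m \<Rightarrow> real" where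
  "fac F y = exp (- (y \<bullet> \<mu>) / \<sigma>\<^sup>2) * (\<Prod>j\<in>UNIV. F j (white y j))"

lemma white_measurable[measurable]: "(\<lambda>y. white y j) \<in> borel_measurable borel"
  unfolding white_def[abs_def] by measurable

lemma fac_measurable:
  assumes "\<And>j. F j \<in> borel_measurable borel"
  shows "fac F \<in> borel_measurable borel"
proof -
  note [measurable] = assms
  show ?thesis unfolding fac_def[abs_def] by measurable
qed

lemma columns_U: "column i U \<bullet> column j U = of_bool (i = j)"
proof -
  have "column i U \<bullet> column j U = (transpose U ** U) $ i $ j"
    by (simp add: matrix_matrix_mult_def transpose_def column_def inner_vec_def)
  thus ?thesis by (simp add: U_orthonormal mat_def)
qed

lemma U_inner: "(U *v z) \<bullet> (U *v z') = z \<bullet> z'"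
  by (metis U_orthonormal dot_lmul_matrix matrix_vector_mul_assoc matrix_vector_mul_lid
      inner_commute transpose_matrix_vector)

lemma inner_U_mult: "v \<bullet> (U *v z) = (\<Sum>j\<in>UNIV. z $ j * (v \<bullet> column j U))"
  by (simp add: matrix_mult_sum inner_sum_right scalar_mult_eq_scaleR)

text \<open>Under the reflected mean, the affine map below turns the coordinates along the columns of U
  into independent standard normal variables.\<close>
lemma has_bochner_integral_white:
  assumes F[measurable]: "\<And>j. F j \<in> borel_measurable borel"
    and I: "\<And>j. has_bochner_integral lborel (\<lambda>x. std_normal_density x * F j x) (s j)"
  shows "has_bochner_integral lborel (\<lambda>y. gdens \<sigma> (- \<mu>) y * (\<Prod>j\<in>UNIV. F j (white y j))) (\<Prod>j\<in>UNIV. s j)"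
proof -
  obtain v :: "'m \<Rightarrow> real^'m" and \<iota> :: "'d \<Rightarrow> 'm" where
    \<iota>: "inj \<iota>" and v: "\<And>i j. v i \<bullet> v j = of_bool (i = j)" and v\<iota>: "\<And>j. v (\<iota> j) = column j U"
    using orthonormal_extend[of "\<lambda>j. column j U"] columns_U by metis
  define Q :: "real^'m \<Rightarrow> real^'m" where "Q x = (\<Sum>i\<in>UNIV. x $ i *\<^sub>R v i)" for x
  have Qv: "Q x \<bullet> v k = x $ k" for x k
    by (simp add: Q_def inner_sum_left v of_bool_def if_distrib cong: if_cong)
  have QQ: "Q x \<bullet> Q y = x \<bullet> y" for x y
  proof -
    have "Q x \<bullet> Q y = (\<Sum>k\<in>UNIV. y $ k * (Q x \<bullet> v k))"
      by (simp add: Q_def[of y] inner_sum_right)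
    thus ?thesis unfolding Qv by (simp add: inner_vec_def[of x] mult.commute)
  qed
  have linQ: "linear Q"
    by (rule linearI) (simp_all add: Q_def scaleR_left_distrib sum.distrib scaleR_sum_right)
  have Q: "orthogonal_transformation Q"
    using linQ QQ by (simp add: orthogonal_transformation_def)
  have [measurable]: "Q \<in> borel_measurable borel"
    by (intro borel_measurable_continuous_onI linear_continuous_on linear_linear[THEN iffD2] linQ)
  \<comment> \<open>Directions added by the extension carry the constant 1, whose Gaussian integral
    is 1, so they do not affect the product.\<close>
  define G where "G i = (if i \<in> range \<iota> then F (inv \<iota> i) else (\<lambda>x. 1))" for i
  define t where "t i = (if i \<in> range \<iota> then s (inv \<iota> i) else 1)" for i
  have prodR: "(\<Prod>i\<in>UNIV. if i \<in> range \<iota> then h (inv \<iota> i) i else 1) = (\<Prod>j\<in>UNIV. h j (\<iota> j))"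
    for h :: "'d \<Rightarrow> 'm \<Rightarrow> real"
  proof -
    have "(\<Prod>i\<in>UNIV. if i \<in> range \<iota> then h (inv \<iota> i) i else 1) = (\<Prod>i\<in>range \<iota>. h (inv \<iota> i) i)"
      by (intro prod.mono_neutral_cong_right) auto
    also have "\<dots> = (\<Prod>j\<in>UNIV. h j (\<iota> j))"
      using \<iota> by (subst prod.reindex) auto
    finally show ?thesis .
  qed
  have It: "has_bochner_integral lborel (\<lambda>x. std_normal_density x * G i x) (t i)" for i
    using I by (auto simp: G_def t_def has_bochner_integral_iff)
  define H0 where "H0 y = gdens \<sigma> (- \<mu>) y * (\<Prod>j\<in>UNIV. F j (white y j))" for y
  have [measurable]: "H0 \<in> borel_measurable borel"
    unfolding H0_def[abs_def] by measurable
  \<comment> \<open>The power of \<sigma> is the Jacobian of y = - \<mu> + \<sigma> Q x; it cancels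
    the \<sigma> in the normalising constant and leaves the standard normal density.\<close>
  have H0: "\<sigma> ^ CARD('m) * H0 (- \<mu> + \<sigma> *\<^sub>R Q x) = (\<Prod>i\<in>UNIV. std_normal_density (x $ i) * G i (x $ i))" for x
  proof -
    have "white (- \<mu> + \<sigma> *\<^sub>R Q x) j = x $ \<iota> j" for j
      using \<sigma>_pos by (simp add: white_def Qv flip: v\<iota>)
    hence "(\<Prod>j\<in>UNIV. F j (white (- \<mu> + \<sigma> *\<^sub>R Q x) j)) = (\<Prod>i\<in>UNIV. G i (x $ i))"
      using prodR[of "\<lambda>j i. F j (x $ i)"] by (simp add: G_def if_distrib[of "\<lambda>f. f _"] cong: if_cong)
    moreover have "\<sigma> ^ CARD('m) * gdens \<sigma> (- \<mu>) (- \<mu> + \<sigma> *\<^sub>R Q x) = (\<Prod>i\<in>UNIV. std_normal_density (x $ i))"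
    proof -
      have "norm (Q x) = norm x" using Q by (simp add: orthogonal_transformation_norm)
      moreover have "\<sigma> ^ CARD('m) * (1 / sqrt (2 * pi * \<sigma>\<^sup>2)) ^ CARD('m) = (1 / sqrt (2 * pi)) ^ CARD('m)"
        using \<sigma>_pos by (simp add: power_mult_distrib[symmetric] real_sqrt_mult)
      ultimately have "\<sigma> ^ CARD('m) * gdens \<sigma> (- \<mu>) (- \<mu> + \<sigma> *\<^sub>R Q x) = gdens 1 0 x"
        using \<sigma>_pos by (simp add: gdens_altdef mult.assoc[symmetric] power_mult_distrib)
      thus ?thesis by (simp add: gdens_def)
    qed
    ultimately show ?thesis by (simp add: H0_def prod.distrib mult.assoc[symmetric])
  qed
  have "has_bochner_integral lborel (\<lambda>x. \<sigma> ^ CARD('m) * H0 (- \<mu> + \<sigma> *\<^sub>R Q x)) (\<Prod>i\<in>UNIV. t i)"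
    unfolding H0 by (rule has_bochner_integral_lborel_prod) (rule It)
  \<comment> \<open>The substitution is undone in two stages: Q by rotation invariance, then scaling
    and translation by \<open>lborel_affine\<close>.\<close>
  hence "has_bochner_integral (distr lborel borel Q) (\<lambda>x. \<sigma> ^ CARD('m) * H0 (- \<mu> + \<sigma> *\<^sub>R x)) (\<Prod>i\<in>UNIV. t i)"
    by (subst has_bochner_integral_distr) auto
  hence "has_bochner_integral lborel (\<lambda>x. \<sigma> ^ CARD('m) * H0 (- \<mu> + \<sigma> *\<^sub>R x)) (\<Prod>i\<in>UNIV. t i)"
    unfolding lborel_distr_orthogonal[OF Q] .
  hence "has_bochner_integral (distr lborel borel (\<lambda>x. - \<mu> + \<sigma> *\<^sub>R x)) (\<lambda>y. \<bar>\<sigma>\<bar> ^ DIM(real^'m) *\<^sub>R H0 y) (\<Prod>i\<in>UNIV. t i)"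
    using \<sigma>_pos by (subst has_bochner_integral_distr) auto
  hence "has_bochner_integral (density (distr lborel borel (\<lambda>x. - \<mu> + \<sigma> *\<^sub>R x))
      (\<lambda>_. ennreal (\<bar>\<sigma>\<bar> ^ DIM(real^'m)))) H0 (\<Prod>i\<in>UNIV. t i)"
    by (intro has_bochner_integral_density) auto
  hence "has_bochner_integral lborel H0 (\<Prod>i\<in>UNIV. t i)"
    using lborel_affine[of \<sigma> "- \<mu>"] \<sigma>_pos by (simp add: ennreal_power)
  also have "(\<Prod>i\<in>UNIV. t i) = (\<Prod>j\<in>UNIV. s j)"
    using prodR[of "\<lambda>j i. s j"] by (simp add: t_def)
  finally show ?thesis by (simp add: H0_def[abs_def])
qed

lemma has_bochner_integral_fac_mult:
  assumes F[measurable]: "\<And>j. F j \<in> borel_measurable borel" "\<And>j. G j \<in> borel_measurable borel"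
    and I: "\<And>j. has_bochner_integral lborel (\<lambda>x. std_normal_density x * (F j x * G j x)) (s j)"
  shows "has_bochner_integral (gauss \<sigma> \<mu>) (\<lambda>y. fac F y * fac G y) (\<Prod>j\<in>UNIV. s j)"
proof -
  \<comment> \<open>Each of the two factors contributes exp(- <y, \<mu>> / \<sigma>^2); over the
    common denominator 2 \<sigma>^2 this is the 4 <y, \<mu>> that completes the square for the mean
    - \<mu>.\<close>
  have *: "norm (y - \<mu>) ^ 2 + 4 * (y \<bullet> \<mu>) = norm (y + \<mu>) ^ 2" for y
    by (simp add: power2_norm_eq_inner inner_simps inner_commute)
  have "gdens \<sigma> \<mu> y * (exp (- (y \<bullet> \<mu>) / \<sigma>\<^sup>2) * exp (- (y \<bullet> \<mu>) / \<sigma>\<^sup>2)) = gdens \<sigma> (- \<mu>) y" for y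
    using \<sigma>_pos by (simp add: gdens_altdef exp_add[symmetric] distrib_left[symmetric] flip: *)
      (simp add: field_simps)
  note g = this
  have eq: "gdens \<sigma> \<mu> y *\<^sub>R (fac F y * fac G y)
      = gdens \<sigma> (- \<mu>) y * (\<Prod>j\<in>UNIV. F j (white y j) * G j (white y j))" for y
    by (simp only: fac_def prod.distrib real_scaleR_def g[symmetric] mult_ac)
  have [measurable]: "fac F \<in> borel_measurable borel" "fac G \<in> borel_measurable borel"
    by (rule fac_measurable, rule F)+
  have "has_bochner_integral lborel (\<lambda>y. gdens \<sigma> \<mu> y *\<^sub>R (fac F y * fac G y)) (\<Prod>j\<in>UNIV. s j)"
    unfolding eq by (rule has_bochner_integral_white) (measurable, rule I)
  thus ?thesis
    unfolding gauss_def by (intro has_bochner_integral_density) (auto simp: gdens_nonneg)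
qed

section \<open>Hermite functions and likelihood ratios in L^2 at the reference mean\<close>

definition hbasis :: "('d \<Rightarrow> nat) \<Rightarrow> real^'m \<Rightarrow> real" where
  "hbasis p y = fac (\<lambda>j. poly (hermite (p j))) y / sqrt (mfact p)"

text \<open>At \<theta> = H x and \<mu> = H x0 this is \<open>rho\<close> of the model, written in
  terms of the means.\<close>

definition lratio :: "real^'m \<Rightarrow> real^'m \<Rightarrow> real" where
  "lratio \<theta> y = exp (((y \<bullet> \<theta>) - (y \<bullet> \<mu>)) / \<sigma>\<^sup>2 - ((norm \<theta>)\<^sup>2 - (norm \<mu>)\<^sup>2) / (2 * \<sigma>\<^sup>2))"

lemma lratio_measurable[measurable]: "lratio \<theta> \<in> borel_measurable borel"
  unfolding lratio_def[abs_def] by measurable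

lemma gdens_lratio: "gdens \<sigma> \<mu> y * lratio \<theta> y = gdens \<sigma> \<theta> y"
proof -
  have "- (norm (y - \<mu>))\<^sup>2 / (2 * \<sigma>\<^sup>2) + (((y \<bullet> \<theta>) - (y \<bullet> \<mu>)) / \<sigma>\<^sup>2 - ((norm \<theta>)\<^sup>2 - (norm \<mu>)\<^sup>2) / (2 * \<sigma>\<^sup>2))
      = - (norm (y - \<theta>))\<^sup>2 / (2 * \<sigma>\<^sup>2)"
  proof -
    have "- (norm (y - \<mu>))\<^sup>2 + (2 * ((y \<bullet> \<theta>) - (y \<bullet> \<mu>)) - ((norm \<theta>)\<^sup>2 - (norm \<mu>)\<^sup>2)) = - (norm (y - \<theta>))\<^sup>2"
      by (simp add: power2_norm_eq_inner inner_simps inner_commute)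
    moreover have "a / (2 * s) + (b / s - c / (2 * s)) = (a + (2 * b - c)) / (2 * s)" for a b c s :: real
      by (simp add: add_divide_distrib diff_divide_distrib)
    ultimately show ?thesis by (simp only:)
  qed
  thus ?thesis by (simp add: gdens_altdef lratio_def exp_add[symmetric])
qed

text \<open>Expectations under all means become inner products at the single mean
  \<open>\<mu>\<close>. The integrability equivalence is recorded because \<open>admissible\<close>
  asks for integrability under each parameter.\<close>

lemma gauss_change_mean:
  assumes [measurable]: "f \<in> borel_measurable borel"
  shows "integrable (gauss \<sigma> \<theta>) f \<longleftrightarrow> integrable (gauss \<sigma> \<mu>) (\<lambda>y. f y * lratio \<theta> y)"
    and "(LINT y|gauss \<sigma> \<theta>. f y) = (LINT y|gauss \<sigma> \<mu>. f y * lratio \<theta> y)"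
proof -
  have eq: "gdens \<sigma> \<mu> y *\<^sub>R (f y * lratio \<theta> y) = gdens \<sigma> \<theta> y *\<^sub>R f y" for y
    by (simp add: gdens_lratio[of y \<theta>, symmetric])
  have dens: "integrable (gauss \<sigma> \<theta>') h = integrable lborel (\<lambda>y. gdens \<sigma> \<theta>' y *\<^sub>R h y)"
    "integral\<^sup>L (gauss \<sigma> \<theta>') h = (LINT y|lborel. gdens \<sigma> \<theta>' y *\<^sub>R h y)"
    if "h \<in> borel_measurable borel" for h :: "real^'m \<Rightarrow> real" and \<theta>'
    unfolding gauss_def
    by (rule integrable_density integral_density; use that in \<open>simp add: gdens_nonneg\<close>)+
  have fl: "(\<lambda>y. f y * lratio \<theta> y) \<in> borel_measurable borel" by measurable
  show "integrable (gauss \<sigma> \<theta>) f \<longleftrightarrow> integrable (gauss \<sigma> \<mu>) (\<lambda>y. f y * lratio \<theta> y)"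
    unfolding dens(1)[OF fl] dens(1)[OF assms] eq ..
  show "(LINT y|gauss \<sigma> \<theta>. f y) = (LINT y|gauss \<sigma> \<mu>. f y * lratio \<theta> y)"
    unfolding dens(2)[OF fl] dens(2)[OF assms] eq ..
qed

text \<open>The exponential prefactor of the series in \<open>coef_set\<close>, with \<sigma> U z in
  place of H x.\<close>

definition lfactor :: "real^'d \<Rightarrow> real" where
  "lfactor z = exp ((norm \<mu>)\<^sup>2 / (2 * \<sigma>\<^sup>2) - (\<sigma> *\<^sub>R (U *v z) \<bullet> \<mu>) / \<sigma>\<^sup>2)"

lemma prod_gen_white:
  "(\<Prod>j\<in>UNIV. gen (z $ j) (white y j)) = exp (((y + \<mu>) \<bullet> (U *v z)) / \<sigma> - (norm (U *v z))\<^sup>2 / 2)"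
proof -
  have 1: "(\<Sum>j\<in>UNIV. z $ j * white y j) = ((y + \<mu>) \<bullet> (U *v z)) / \<sigma>"
    by (simp add: inner_U_mult white_def sum_divide_distrib)
  have 2: "(\<Sum>j\<in>UNIV. (z $ j)\<^sup>2) = (norm (U *v z))\<^sup>2"
    by (simp add: power2_norm_eq_inner U_inner) (simp add: inner_vec_def power2_eq_square)
  show ?thesis
    unfolding gen_def by (subst exp_sum[symmetric]) (simp_all add: sum_subtractf 1 2 sum_divide_distrib[symmetric])
qed

text \<open>Since U^T U = 1, the term |U z|^2 splits over coordinates, and the z-dependent part of
  the exponent becomes a product of one-dimensional generating functions.\<close>

lemma lratio_fac: "lratio (\<sigma> *\<^sub>R (U *v z)) y = lfactor z * fac (\<lambda>j. gen (z $ j)) y"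
proof -
  \<comment> \<open>Here k is <U z, \<mu>>: it enters through the shift y + \<mu> in
    \<open>white\<close> and is cancelled by the one in \<open>lfactor\<close>.\<close>
  have *: "(\<sigma> * a - b) / \<sigma>\<^sup>2 - (\<sigma>\<^sup>2 * n - m) / (2 * \<sigma>\<^sup>2) =
      (m / (2 * \<sigma>\<^sup>2) - \<sigma> * k / \<sigma>\<^sup>2) + (- b / \<sigma>\<^sup>2 + ((a + k) / \<sigma> - n / 2))" for a b n m k :: real
    using \<sigma>_pos by (simp add: power2_eq_square field_simps)
  show ?thesis
    unfolding lratio_def lfactor_def fac_def prod_gen_white
    using *[of "y \<bullet> (U *v z)" "y \<bullet> \<mu>" "(norm (U *v z))\<^sup>2" "(norm \<mu>)\<^sup>2" "(U *v z) \<bullet> \<mu>"]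
    by (simp add: exp_add[symmetric] power_mult_distrib inner_add_left inner_commute[of \<mu>])
qed

lemma hbasis_measurable[measurable]: "hbasis p \<in> borel_measurable borel"
  unfolding hbasis_def[abs_def] by (intro borel_measurable_divide fac_measurable poly_borel) auto

lemma hbasis_orthonormal:
  "has_bochner_integral (gauss \<sigma> \<mu>) (\<lambda>y. hbasis p y * hbasis q y) (of_bool (p = q))"
proof -
  have "has_bochner_integral (gauss \<sigma> \<mu>)
      (\<lambda>y. fac (\<lambda>j. poly (hermite (p j))) y * fac (\<lambda>j. poly (hermite (q j))) y)
      (\<Prod>j\<in>UNIV. fact (q j) * of_bool (p j = q j))"
    by (intro has_bochner_integral_fac_mult poly_borel gauss_hermite_hermite)
  also have "(\<Prod>j\<in>UNIV. fact (q j) * of_bool (p j = q j)) = mfact q * of_bool (p = q)"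
    by (auto simp: mfact_def fun_eq_iff)
  finally have "has_bochner_integral (gauss \<sigma> \<mu>)
      (\<lambda>y. 1 / (sqrt (mfact p) * sqrt (mfact q)) *
        (fac (\<lambda>j. poly (hermite (p j))) y * fac (\<lambda>j. poly (hermite (q j))) y))
      (1 / (sqrt (mfact p) * sqrt (mfact q)) * (mfact q * of_bool (p = q)))"
    by (rule has_bochner_integral_mult_right)
  moreover have "1 / (sqrt (mfact p) * sqrt (mfact q)) * (mfact q * of_bool (p = q)) = of_bool (p = q)"
    using mfact_pos[of q] by (cases "p = q") auto
  ultimately show ?thesis by (simp add: hbasis_def)
qed

lemma hbasis_sqint: "hbasis p \<in> sqint (gauss \<sigma> \<mu>)"
  using hbasis_orthonormal[of p p]
  by (auto simp: sqint_def has_bochner_integral_iff power2_eq_square)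

sublocale hbasis: orthonormal_family "gauss \<sigma> \<mu>" hbasis
proof -
  interpret prob_space "gauss \<sigma> \<mu>" by (rule prob_space_gauss) (rule \<sigma>_pos)
  show "orthonormal_family (gauss \<sigma> \<mu>) hbasis"
    by unfold_locales (use hbasis_sqint hbasis_orthonormal in \<open>auto simp: has_bochner_integral_iff\<close>)
qed

lemma lratio_square:
  "has_bochner_integral (gauss \<sigma> \<mu>) (\<lambda>y. (lratio (\<sigma> *\<^sub>R (U *v z)) y)\<^sup>2)
     ((lfactor z)\<^sup>2 * (\<Prod>j\<in>UNIV. exp ((z $ j)\<^sup>2)))"
proof -
  have "has_bochner_integral (gauss \<sigma> \<mu>)
      (\<lambda>y. (lfactor z)\<^sup>2 * (fac (\<lambda>j. gen (z $ j)) y * fac (\<lambda>j. gen (z $ j)) y))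
      ((lfactor z)\<^sup>2 * (\<Prod>j\<in>UNIV. exp ((z $ j)\<^sup>2)))"
    by (intro has_bochner_integral_mult_right has_bochner_integral_fac_mult gen_borel gauss_gen_gen)
  thus ?thesis by (simp add: lratio_fac power2_eq_square mult_ac)
qed

lemma lratio_sqint: "lratio (\<sigma> *\<^sub>R (U *v z)) \<in> sqint (gauss \<sigma> \<mu>)"
  using lratio_square[of z] by (auto simp: sqint_def has_bochner_integral_iff)

lemma lratio_hbasis:
  "(LINT y|gauss \<sigma> \<mu>. lratio (\<sigma> *\<^sub>R (U *v z)) y * hbasis p y) = lfactor z * (mpow z p / sqrt (mfact p))"
proof -
  have "has_bochner_integral (gauss \<sigma> \<mu>)
      (\<lambda>y. lfactor z / sqrt (mfact p) * (fac (\<lambda>j. gen (z $ j)) y * fac (\<lambda>j. poly (hermite (p j))) y))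
      (lfactor z / sqrt (mfact p) * (\<Prod>j\<in>UNIV. (z $ j) ^ p j))"
    by (intro has_bochner_integral_mult_right has_bochner_integral_fac_mult gen_borel poly_borel gauss_gen_hermite)
  hence "(LINT y|gauss \<sigma> \<mu>. lfactor z / sqrt (mfact p) *
      (fac (\<lambda>j. gen (z $ j)) y * fac (\<lambda>j. poly (hermite (p j))) y)) = lfactor z / sqrt (mfact p) * mpow z p"
    unfolding mpow_def by (rule has_bochner_integral_integral_eq)
  thus ?thesis
    by (simp add: lratio_fac hbasis_def mult.assoc del: integral_mult_right_zero integral_divide_zero)
qed

text \<open>Equality in Bessel's inequality: both the squared norm and the square sum of the
  coefficients equal lfactor(z)^2 times the product of the exp(z_j^2).\<close>

lemma lratio_expands:
  "hbasis.expands (\<lambda>p. lfactor z * (mpow z p / sqrt (mfact p))) (lratio (\<sigma> *\<^sub>R (U *v z)))"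
proof (rule hbasis.expandsI_Parseval[OF lratio_sqint lratio_hbasis])
  let ?f = "\<lambda>p. (lfactor z * (mpow z p / sqrt (mfact p)))\<^sup>2"
  have "?f summable_on UNIV"
    using hbasis.Bessel(1)[OF lratio_sqint[of z]] by (simp add: lratio_hbasis)
  moreover have "infsum ?f UNIV = (LINT y|gauss \<sigma> \<mu>. (lratio (\<sigma> *\<^sub>R (U *v z)) y)\<^sup>2)"
  proof -
    have "?f p = (lfactor z)\<^sup>2 * (\<Prod>j\<in>UNIV. ((z $ j)\<^sup>2) ^ p j / fact (p j))" for p
      using mfact_pos[of p]
      by (simp add: power_mult_distrib power_divide mpow_def mfact_def prod_dividef
          prod_power_distrib power_mult[symmetric] mult.commute)
    hence "infsum ?f UNIV = (lfactor z)\<^sup>2 * (\<Prod>j\<in>UNIV. exp ((z $ j)\<^sup>2))"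
      by (simp add: infsum_cmult_right' infsum_multi_exp)
    thus ?thesis using lratio_square[of z] by (simp add: has_bochner_integral_iff)
  qed
  ultimately show "(?f has_sum (LINT y|gauss \<sigma> \<mu>. (lratio (\<sigma> *\<^sub>R (U *v z)) y)\<^sup>2)) UNIV"
    using has_sum_infsum[of ?f UNIV] by (simp only:)
qed

end

section \<open>Mixed derivatives of the generating function\<close>

text \<open>For q = 0 this is the generating function, at z = 0 the product of Hermite polynomials,
  and differentiation in z_i only raises q_i.\<close>

definition hprod :: "('d::finite \<Rightarrow> real) \<Rightarrow> ('d \<Rightarrow> nat) \<Rightarrow> real^'d \<Rightarrow> real" where
  "hprod w q z = (\<Prod>j\<in>UNIV. poly (hermite (q j)) (w j - z $ j) * exp (w j * z $ j - (z $ j)\<^sup>2 / 2))"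

lemma partial_hprod:
  "partial i (\<lambda>z. K * hprod w q z) = (\<lambda>z. K * hprod w (q(i := Suc (q i))) z)"
proof
  fix z :: "real^'a"
  define h where "h n j x = poly (hermite n) (w j - x) * exp (w j * x - x\<^sup>2 / 2)" for n j x
  define R where "R = (\<Prod>j\<in>UNIV - {i}. h (q j) j (z $ j))"
  have hp: "hprod w q' z' = h (q' i) i (z' $ i) * (\<Prod>j\<in>UNIV - {i}. h (q' j) j (z' $ j))" for q' z'
    unfolding hprod_def h_def by (rule prod.remove) auto
  have 1: "hprod w q (z + t *\<^sub>R axis i 1) = h (q i) i (z $ i + t) * R" for t
    unfolding hp R_def by (auto simp: axis_def intro!: prod.cong)
  have 2: "hprod w (q(i := Suc (q i))) z = h (Suc (q i)) i (z $ i) * R"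
    unfolding hp R_def by (auto intro!: prod.cong)
  have "(h (q i) i has_real_derivative h (Suc (q i)) i (z $ i)) (at (z $ i + 0))"
    unfolding h_def[abs_def] add_0_right by (rule DERIV_hermite_exp)
  hence "((\<lambda>t. h (q i) i (z $ i + t)) has_real_derivative h (Suc (q i)) i (z $ i)) (at 0)"
    using DERIV_at_within_shift[of "h (q i) i" _ "z $ i" 0 UNIV] by simp
  hence "((\<lambda>t. K * (h (q i) i (z $ i + t) * R)) has_real_derivative K * (h (Suc (q i)) i (z $ i) * R)) (at 0)"
    by (intro DERIV_cmult DERIV_cmult_right)
  thus "partial i (\<lambda>z. K * hprod w q z) z = K * hprod w (q(i := Suc (q i))) z"
    unfolding partial_def 1 2 by (rule DERIV_imp_deriv)
qed

text \<open>The order of differentiation in \<open>mixed_deriv\<close> is an unspecified enumeration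
  of the coordinates. The induction records only the set already treated, so the outcome is the same
  for every enumeration without repetition.\<close>

lemma mixed_deriv_hprod:
  "mixed_deriv p (\<lambda>z. K * hprod w (\<lambda>_. 0) z) = (\<lambda>z. K * hprod w p z)"
proof -
  have iter: "(partial i ^^ n) (\<lambda>z. K * hprod w q z) = (\<lambda>z. K * hprod w (q(i := q i + n)) z)" for i n q
  proof (induction n)
    case (Suc n)
    have "(q(i := q i + n))(i := Suc ((q(i := q i + n)) i)) = q(i := q i + Suc n)" by simp
    thus ?case
      using partial_hprod[of i K w "q(i := q i + n)"] by (simp only: funpow.simps comp_apply Suc.IH)
  qed simp
  define xs :: "'a list" where "xs = (SOME xs. distinct xs \<and> set xs = UNIV)"
  have xs: "distinct xs \<and> set xs = UNIV"
    unfolding xs_def by (rule someI_ex) (metis finite_distinct_list finite)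
  have "foldr (\<lambda>i h. (partial i ^^ p i) h) ys (\<lambda>z. K * hprod w (\<lambda>_. 0) z)
      = (\<lambda>z. K * hprod w (\<lambda>i. if i \<in> set ys then p i else 0) z)" if "distinct ys" for ys
    using that
  proof (induction ys)
    case (Cons i ys)
    have "(\<lambda>j. if j \<in> set ys then p j else 0)(i := p i) = (\<lambda>j. if j \<in> set (i # ys) then p j else 0)"
      by auto
    with Cons show ?case by (simp add: iter fun_upd_def cong: if_cong)
  qed simp
  from this[of xs] xs show ?thesis by (simp add: mixed_deriv_def xs_def[symmetric])
qed

section \<open>Matrices of the thin singular value decomposition\<close>

text \<open>\<open>matrix_inv\<close> is a choice among two-sided inverses, so one has to be
  exhibited: the diagonal matrix of reciprocals.\<close>

lemma thin_svd_inverse: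
  assumes "thin_svd H U Sg V"
  shows "Sg ** matrix_inv Sg = mat 1" "matrix_inv Sg ** Sg = mat 1"
proof -
  define T where "T = (\<chi> i j. if i = j then 1 / Sg $ i $ i else 0)"
  have off: "i \<noteq> j \<Longrightarrow> Sg $ i $ j = 0" and pos: "Sg $ i $ i > 0" for i j
    using assms unfolding thin_svd_def by blast+
  have "Sg $ i $ k * T $ k $ j = (if k = i then of_bool (i = j) else 0)"
    "T $ i $ k * Sg $ k $ j = (if k = i then of_bool (i = j) else 0)" for i j k
    using off[of i k] off[of k j] pos[of i] by (auto simp: T_def)
  hence "Sg ** T = mat 1" "T ** Sg = mat 1"
    by (simp_all add: vec_eq_iff matrix_matrix_mult_def mat_def)
  hence "\<exists>T. Sg ** T = mat 1 \<and> T ** Sg = mat 1" by blast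
  from someI_ex[OF this] show "Sg ** matrix_inv Sg = mat 1" "matrix_inv Sg ** Sg = mat 1"
    by (simp_all add: matrix_inv_def)
qed

text \<open>The reason for the choice of \<open>Ht\<close>: after composition with H only the
  orthonormal columns of U remain.\<close>

lemma thin_svd_mult:
  assumes "thin_svd H U Sg V"
  shows "H ** (V ** matrix_inv Sg) = U"
proof -
  have H: "H = U ** Sg ** transpose V" using assms by (simp add: thin_svd_def)
  have "H ** (V ** matrix_inv Sg) = U ** (Sg ** (transpose V ** V) ** matrix_inv Sg)"
    by (simp only: H matrix_mul_assoc)
  thus ?thesis
    using assms thin_svd_inverse[OF assms] by (simp add: thin_svd_def)
qed

text \<open>For any Moore-Penrose inverse X the projections A X and A L coincide.\<close>
lemma pinv_eqI:
  fixes A :: "real^'b^'a" and L :: "real^'a^'b"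
  assumes LA: "L ** A = mat 1" and sym: "transpose (A ** L) = A ** L"
  shows "pinv A = L"
  unfolding pinv_def
proof (rule the_equality)
  show "A ** L ** A = A \<and> L ** A ** L = L \<and> transpose (A ** L) = A ** L \<and> transpose (L ** A) = L ** A"
    using LA sym by (simp add: matrix_mul_assoc[symmetric] transpose_mat)
next
  fix X assume X: "A ** X ** A = A \<and> X ** A ** X = X \<and>
      transpose (A ** X) = A ** X \<and> transpose (X ** A) = X ** A"
  have "(A ** X) ** (A ** L) = A ** L"
    using X by (simp add: matrix_mul_assoc)
  moreover have "(A ** L) ** (A ** X) = A ** X"
    by (simp add: matrix_mul_assoc[symmetric] LA) (simp add: matrix_mul_assoc LA)
  moreover have "transpose ((A ** L) ** (A ** X)) = (A ** X) ** (A ** L)"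
    using X sym by (simp only: matrix_transpose_mul[of "A ** L"])
  ultimately have "A ** X = A ** L"
    using X by simp
  hence "L ** (A ** X) = L ** (A ** L)" by simp
  hence "(L ** A) ** X = (L ** A) ** L" by (simp only: matrix_mul_assoc)
  thus "X = L" by (simp add: LA)
qed

text \<open>The candidate is a left inverse of V Sg^(-1), and the product in the other order is the
  symmetric projection V V^T.\<close>

lemma thin_svd_pinv:
  assumes svd: "thin_svd H U Sg V"
  shows "pinv (V ** matrix_inv Sg) = Sg ** transpose V"
proof (rule pinv_eqI)
  have V: "transpose V ** V = mat 1" using svd by (simp add: thin_svd_def)
  show "Sg ** transpose V ** (V ** matrix_inv Sg) = mat 1"
  proof -
    have "Sg ** transpose V ** (V ** matrix_inv Sg) = Sg ** (transpose V ** V) ** matrix_inv Sg"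
      by (simp only: matrix_mul_assoc)
    thus ?thesis by (simp add: V thin_svd_inverse[OF svd])
  qed
  have "V ** matrix_inv Sg ** (Sg ** transpose V) = V ** transpose V"
  proof -
    have "V ** matrix_inv Sg ** (Sg ** transpose V) = V ** (matrix_inv Sg ** Sg) ** transpose V"
      by (simp only: matrix_mul_assoc)
    thus ?thesis by (simp add: thin_svd_inverse[OF svd])
  qed
  thus "transpose (V ** matrix_inv Sg ** (Sg ** transpose V)) = V ** matrix_inv Sg ** (Sg ** transpose V)"
    by (simp add: matrix_transpose_mul)
qed

text \<open>The D-dimensional parameter pinv(Ht) x thus determines the whole mean H x.\<close>

lemma thin_svd_pinv_mult:
  assumes svd: "thin_svd H U Sg V"
  shows "U *v (pinv (V ** matrix_inv Sg) *v x) = H *v x"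
  unfolding thin_svd_pinv[OF svd]
  using svd by (simp add: thin_svd_def matrix_vector_mul_assoc matrix_mul_assoc)

section \<open>Minimum norm solutions of moment problems\<close>

context orthonormal_family
begin

definition coef_solutions :: "'x set \<Rightarrow> ('x \<Rightarrow> 'i \<Rightarrow> real) \<Rightarrow> ('x \<Rightarrow> real) \<Rightarrow> ('i \<Rightarrow> real) set" where
  "coef_solutions X r t =
    {a. (\<lambda>p. (a p)\<^sup>2) summable_on UNIV \<and> (\<forall>x\<in>X. (\<Sum>\<^sub>\<infinity>p. a p * r x p) = t x)}"

lemma expands_moment:
  assumes R: "\<And>x. x \<in> X \<Longrightarrow> expands (r x) (R x)"
    and a: "a \<in> coef_solutions X r t" and g: "expands a g"
  shows "g \<in> moment_set M X R t"
proof -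
  have "(LINT y|M. g y * R x y) = t x" if "x \<in> X" for x
  proof -
    have "((\<lambda>p. a p * r x p) has_sum (LINT y|M. g y * R x y)) UNIV"
      using expands_inner[OF g expands_sqint[OF R[OF that]]] by (simp add: expands_coeff[OF R[OF that]])
    from infsumI[OF this] show ?thesis
      using a that by (simp add: coef_solutions_def)
  qed
  thus ?thesis using expands_sqint[OF g] by (simp add: moment_set_def)
qed

lemma moment_coefs:
  assumes R: "\<And>x. x \<in> X \<Longrightarrow> expands (r x) (R x)" and f: "f \<in> moment_set M X R t"
  shows "(\<lambda>p. LINT y|M. f y * e p y) \<in> coef_solutions X r t"
proof -
  have sq: "f \<in> sqint M" using f by (simp add: moment_set_def)
  have "(\<Sum>\<^sub>\<infinity>p. (LINT y|M. f y * e p y) * r x p) = t x" if "x \<in> X" for x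
    using infsumI[OF expands_inner[OF R[OF that] sq]] f that
    by (simp add: moment_set_def mult.commute)
  thus ?thesis using Bessel(1)[OF sq] by (simp add: coef_solutions_def)
qed

text \<open>One number m serves as the minimum on both sides: expanding a coefficient solution gives
  a moment solution of the same norm, and taking coefficients of a moment solution cannot increase
  the norm.\<close>

lemma min_norm_moment:
  assumes R: "\<And>x. x \<in> X \<Longrightarrow> expands (r x) (R x)" and ne: "moment_set M X R t \<noteq> {}"
  obtains m where
    "\<And>f. f \<in> moment_set M X R t \<Longrightarrow> m \<le> (LINT y|M. (f y)\<^sup>2)"
    "\<And>f g. f \<in> moment_set M X R t \<Longrightarrow> g \<in> moment_set M X R t \<Longrightarrow>
        (LINT y|M. (f y)\<^sup>2) = m \<Longrightarrow> (LINT y|M. (g y)\<^sup>2) = m \<Longrightarrow> AE y in M. g y = f y"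
    "\<And>a. a \<in> coef_solutions X r t \<Longrightarrow> m \<le> (\<Sum>\<^sub>\<infinity>p. (a p)\<^sup>2)"
    "\<exists>!a. a \<in> coef_solutions X r t \<and> (\<Sum>\<^sub>\<infinity>p. (a p)\<^sup>2) = m"
proof -
  have Rsq: "\<And>x. x \<in> X \<Longrightarrow> R x \<in> sqint M" using R by (rule expands_sqint)
  let ?A = "moment_set M X R t" and ?C = "coef_solutions X r t"
  obtain f where f: "f \<in> ?A" and fmin: "\<And>h. h \<in> ?A \<Longrightarrow> (LINT y|M. (f y)\<^sup>2) \<le> (LINT y|M. (h y)\<^sup>2)"
    using moment_set_min_exists[OF Rsq ne] by blast
  define m where "m = (LINT y|M. (f y)\<^sup>2)"
  have uniq: "AE y in M. h y = g y"
    if "g \<in> ?A" "h \<in> ?A" "(LINT y|M. (g y)\<^sup>2) = m" "(LINT y|M. (h y)\<^sup>2) = m" for g h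
    using that fmin by (intro moment_set_min_unique[OF Rsq that(1,2)]) (auto simp: m_def)
  have T: "\<exists>g. expands a g \<and> g \<in> ?A \<and> (LINT y|M. (g y)\<^sup>2) = (\<Sum>\<^sub>\<infinity>p. (a p)\<^sup>2)" if a: "a \<in> ?C" for a
  proof -
    obtain g where g: "expands a g"
      using expands_exists[of a] a by (auto simp: coef_solutions_def)
    with expands_moment[OF R a g] infsumI[OF Parseval[OF g]] show ?thesis by auto
  qed
  have lower: "m \<le> (\<Sum>\<^sub>\<infinity>p. (a p)\<^sup>2)" if a: "a \<in> ?C" for a
  proof -
    obtain g where "g \<in> ?A" "(LINT y|M. (g y)\<^sup>2) = (\<Sum>\<^sub>\<infinity>p. (a p)\<^sup>2)" using T[OF a] by blast
    with fmin[of g] show ?thesis by (simp add: m_def)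
  qed
  \<comment> \<open>The coefficients of the minimiser: Bessel bounds their square sum above by m,
    and the lower bound for all coefficient solutions gives equality.\<close>
  define a0 where "a0 = (\<lambda>p. LINT y|M. f y * e p y)"
  have a0: "a0 \<in> ?C" unfolding a0_def by (rule moment_coefs[OF R f])
  have "(\<Sum>\<^sub>\<infinity>p. (a0 p)\<^sup>2) = m"
    using lower[OF a0] Bessel(2)[of f] f by (auto simp: a0_def m_def moment_set_def)
  \<comment> \<open>Minimal coefficient solutions expand to minimal functions, which agree almost
    everywhere; integrating against the basis reads the coefficients back.\<close>
  moreover have "a = b"
    if ab: "a \<in> ?C" "b \<in> ?C" "(\<Sum>\<^sub>\<infinity>p. (a p)\<^sup>2) = m" "(\<Sum>\<^sub>\<infinity>p. (b p)\<^sup>2) = m" for a b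
  proof
    fix q
    obtain g h where g: "expands a g" "g \<in> ?A" "(LINT y|M. (g y)\<^sup>2) = m"
      and h: "expands b h" "h \<in> ?A" "(LINT y|M. (h y)\<^sup>2) = m"
      using T[OF ab(1)] T[OF ab(2)] ab by auto
    have [measurable]: "g \<in> borel_measurable M" "h \<in> borel_measurable M" "e q \<in> borel_measurable M"
      using g(1) h(1) e_sqint by (auto simp: expands_def sqint_def)
    have "(LINT y|M. g y * e q y) = (LINT y|M. h y * e q y)"
      using uniq[OF g(2) h(2) g(3) h(3)] by (intro integral_cong_AE) auto
    thus "a q = b q" by (simp add: expands_coeff[OF g(1)] expands_coeff[OF h(1)])
  qed
  ultimately have "\<exists>!a. a \<in> ?C \<and> (\<Sum>\<^sub>\<infinity>p. (a p)\<^sup>2) = m"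
    using a0 by (intro ex1I[of _ a0]) auto
  with that[of m] fmin uniq lower show thesis by (auto simp: m_def)
qed

end

section \<open>The sparse linear Gaussian model\<close>

text \<open>The factor exp(<H x0, H Ht z> / \<sigma>) in \<open>chi\<close> supplies the shift from
  y to y + \<mu>, so the function differentiated there is the generating function at
  \<open>white y\<close> times a quantity free of z.\<close>

lemma chi_hermite:
  assumes "whitened_model \<sigma> U" and HHt: "H ** Ht = U"
  shows "chi \<sigma> H x0 Ht p y = exp ((norm (H *v x0))\<^sup>2 / (2 * \<sigma>\<^sup>2)) *
    whitened_model.fac \<sigma> U (H *v x0) (\<lambda>j. poly (hermite (p j))) y"
proof -
  define \<mu> where "\<mu> = H *v x0"
  interpret whitened_model \<sigma> U \<mu> by fact
  define K where "K = exp (- (y \<bullet> \<mu>) / \<sigma>\<^sup>2 + (norm \<mu>)\<^sup>2 / (2 * \<sigma>\<^sup>2))"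
  have "rho \<sigma> H x0 y (\<sigma> *\<^sub>R (Ht *v z)) * exp ((1 / \<sigma>) * ((H *v x0) \<bullet> (H *v (Ht *v z))))
      = K * hprod (white y) (\<lambda>_. 0) z" for z
  proof -
    have w: "H *v (Ht *v z) = U *v z" by (simp add: matrix_vector_mul_assoc HHt)
    have H: "H *v (\<sigma> *\<^sub>R (Ht *v z)) = \<sigma> *\<^sub>R (U *v z)"
      "H *v (x0 - \<sigma> *\<^sub>R (Ht *v z)) = \<mu> - \<sigma> *\<^sub>R (U *v z)"
      by (simp_all add: matrix_vector_mult_diff_distrib matrix_vector_mult_scaleR w \<mu>_def)
    have *: "- (1 / (2 * \<sigma>\<^sup>2)) * (2 * (b - \<sigma> * a) + \<sigma>\<^sup>2 * n - m) + 1 / \<sigma> * k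
        = (- b / \<sigma>\<^sup>2 + m / (2 * \<sigma>\<^sup>2)) + ((a + k) / \<sigma> - n / 2)" for a b n m k :: real
      using \<sigma>_pos by (simp add: power2_eq_square field_simps)
    have "hprod (white y) (\<lambda>_. 0) z = (\<Prod>j\<in>UNIV. gen (z $ j) (white y j))"
      by (simp add: hprod_def gen_def mult.commute)
    thus ?thesis
      using *[of "y \<bullet> \<mu>" "y \<bullet> (U *v z)" "(norm (U *v z))\<^sup>2" "(norm \<mu>)\<^sup>2" "\<mu> \<bullet> (U *v z)"]
      unfolding rho_def H w \<mu>_def[symmetric] prod_gen_white K_def
      by (simp add: exp_add[symmetric] power_mult_distrib inner_add_left inner_diff_right)
  qed
  hence "chi \<sigma> H x0 Ht p y = K * hprod (white y) p 0"
    by (simp add: chi_def mixed_deriv_hprod)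
  thus ?thesis
    unfolding \<mu>_def[symmetric] K_def exp_add by (simp add: hprod_def fac_def)
qed

theorem theorem6:
  fixes H :: "real^'n^'m" and \<sigma> :: real and S :: nat
    and g c :: "real^'n \<Rightarrow> real" and x0 :: "real^'n"
    and U :: "real^'d::finite^'m" and Sg :: "real^'d^'d" and V :: "real^'d^'n"
  assumes S: "1 \<le> S" "S \<le> CARD('n)"
    and spark: "spark H > S"
    and sigma: "\<sigma> > 0"
    and x0: "x0 \<in> sparse_set S"
    and D: "CARD('d) = rank H"
    and svd: "thin_svd H U Sg V"
    and valid: "valid_bias \<sigma> H S g c x0"
  defines "Ht \<equiv> V ** matrix_inv Sg"
    and "\<gamma> \<equiv> (\<lambda>x. c x + g x)"
  shows "(\<exists>a\<in>coef_set \<sigma> H S g c x0 Ht.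
        min_var \<sigma> H S g c x0 = (\<Sum>\<^sub>\<infinity>p. (a p)\<^sup>2) - (\<gamma> x0)\<^sup>2) \<and>
     (\<forall>a\<in>coef_set \<sigma> H S g c x0 Ht.
        min_var \<sigma> H S g c x0 \<le> (\<Sum>\<^sub>\<infinity>p. (a p)\<^sup>2) - (\<gamma> x0)\<^sup>2) \<and>
     (\<forall>a\<in>coef_set \<sigma> H S g c x0 Ht.
        (\<exists>gh. is_series_estimator \<sigma> H x0 Ht a gh) \<and>
        (\<forall>gh. is_series_estimator \<sigma> H x0 Ht a gh \<longrightarrow> gh \<in> admissible \<sigma> H S g c x0)) \<and>
     (\<exists>!a0. a0 \<in> coef_set \<sigma> H S g c x0 Ht \<and>
          (\<forall>a\<in>coef_set \<sigma> H S g c x0 Ht. l2norm a0 \<le> l2norm a)) \<and>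
     (\<forall>a0. a0 \<in> coef_set \<sigma> H S g c x0 Ht \<and>
          (\<forall>a\<in>coef_set \<sigma> H S g c x0 Ht. l2norm a0 \<le> l2norm a) \<longrightarrow>
       (\<forall>gh. is_series_estimator \<sigma> H x0 Ht a0 gh \<longrightarrow>
          is_LMV \<sigma> H S g c x0 gh \<and>
          (\<forall>gh'. is_LMV \<sigma> H S g c x0 gh' \<longrightarrow> (AE y in obs \<sigma> H x0. gh' y = gh y))))"
proof -
  define \<mu> where "\<mu> = H *v x0"
  have model: "whitened_model \<sigma> U"
    using svd sigma by (simp add: whitened_model_def thin_svd_def)
  interpret whitened_model \<sigma> U \<mu> by (rule model)
  define M where "M = gauss \<sigma> \<mu>"
  have obs0: "obs \<sigma> H x0 = M" by (simp add: obs_eq_gauss M_def \<mu>_def)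
  have setsM: "borel_measurable M = borel_measurable borel"
    by (rule measurable_cong_sets) (simp_all add: M_def sets_gauss)
  define z where "z x = (1 / \<sigma>) *\<^sub>R (pinv Ht *v x)" for x
  have Hz: "H *v x = \<sigma> *\<^sub>R (U *v z x)" for x
    using sigma thin_svd_pinv_mult[OF svd, of x]
    by (simp add: z_def Ht_def matrix_vector_mult_scaleR)
  define R where "R x = lratio (H *v x)" for x
  define r where "r x p = lfactor (z x) * (mpow (z x) p / sqrt (mfact p))" for x p
  have R: "hbasis.expands (r x) (R x)" for x
    unfolding R_def Hz r_def[abs_def] by (rule lratio_expands)
  have R_sq: "R x \<in> sqint M" for x unfolding M_def by (rule hbasis.expands_sqint[OF R])
  let ?A = "admissible \<sigma> H S g c x0" and ?C = "coef_set \<sigma> H S g c x0 Ht"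

  \<comment> \<open>Integrability under every x comes for free here, as the product of two
    square-integrable functions at \<open>x0\<close>; a function that is not square integrable lies
    in neither set.\<close>
  have A: "?A = moment_set M (sparse_set S) R \<gamma>"
  proof -
    have "gh \<in> ?A \<longleftrightarrow> gh \<in> moment_set M (sparse_set S) R \<gamma>" for gh
    proof (cases "gh \<in> sqint M")
      case True
      hence b: "gh \<in> borel_measurable borel" using setsM by (auto simp: sqint_def)
      have "integrable (obs \<sigma> H x) gh" "mean_est \<sigma> H x gh = (LINT y|M. gh y * R x y)" for x
        using sqint_integrable_mult[OF True R_sq, of x]
        by (simp_all add: mean_est_def obs_eq_gauss gauss_change_mean[OF b] R_def M_def)
      moreover have "finite_var \<sigma> H x0 gh"
        using True b by (simp add: finite_var_def obs0 sqint_def)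
      ultimately show ?thesis
        using True by (auto simp: admissible_def moment_set_def \<gamma>_def algebra_simps)
    next
      case False
      thus ?thesis
        using setsM by (auto simp: admissible_def moment_set_def finite_var_def obs0 sqint_def)
    qed
    thus ?thesis by blast
  qed

  have C: "?C = hbasis.coef_solutions (sparse_set S) r \<gamma>"
  proof -
    have lf: "exp ((1 / (2 * \<sigma>\<^sup>2)) * (norm (H *v x0))\<^sup>2 - (1 / \<sigma>\<^sup>2) * ((H *v x) \<bullet> (H *v x0))) = lfactor (z x)" for x
      unfolding lfactor_def Hz[symmetric] by (simp add: \<mu>_def)
    have "(\<Sum>\<^sub>\<infinity>p. a p * r x p) = lfactor (z x) * (\<Sum>\<^sub>\<infinity>p. a p / sqrt (mfact p) * mpow (z x) p)" for a x
      by (subst infsum_cmult_right'[symmetric]) (simp add: r_def mult_ac)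
    thus ?thesis
      unfolding coef_set_def hbasis.coef_solutions_def l2_def lf z_def[symmetric] \<gamma>_def
      by (auto simp: algebra_simps)
  qed

  have est: "est_term \<sigma> H x0 Ht a p y = a p * hbasis p y" for a p y
  proof -
    have "H ** Ht = U" unfolding Ht_def by (rule thin_svd_mult[OF svd])
    note chi = chi_hermite[OF model this, of x0 p y, folded \<mu>_def]
    \<comment> \<open>The prefactor of the series estimator is exactly what removes the constant in
      \<open>chi\<close>.\<close>
    have "exp (- (norm \<mu>)\<^sup>2 / (2 * \<sigma>\<^sup>2)) * exp ((norm \<mu>)\<^sup>2 / (2 * \<sigma>\<^sup>2)) = 1"
      by (simp add: exp_add[symmetric])
    thus ?thesis
      unfolding est_term_def hbasis_def \<mu>_def[symmetric] chi by simp
  qed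
  have ser: "is_series_estimator \<sigma> H x0 Ht a gh \<longleftrightarrow> hbasis.expands a gh" for a gh
    unfolding is_series_estimator_def hbasis.expands_def hbasis.psum_def est obs0
    by (simp only: setsM[unfolded M_def] M_def)

  have ne: "moment_set (gauss \<sigma> \<mu>) (sparse_set S) R \<gamma> \<noteq> {}"
    using valid unfolding valid_bias_def A M_def .
  have "\<exists>m. (\<forall>f\<in>?A. m \<le> (LINT y|M. (f y)\<^sup>2)) \<and>
      (\<forall>f\<in>?A. \<forall>h\<in>?A. (LINT y|M. (f y)\<^sup>2) = m \<longrightarrow> (LINT y|M. (h y)\<^sup>2) = m \<longrightarrow> (AE y in M. h y = f y)) \<and>
      (\<forall>a\<in>?C. m \<le> (\<Sum>\<^sub>\<infinity>p. (a p)\<^sup>2)) \<and> (\<exists>!a. a \<in> ?C \<and> (\<Sum>\<^sub>\<infinity>p. (a p)\<^sup>2) = m)"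
    unfolding A C M_def
    by (rule hbasis.min_norm_moment[OF R ne]) (intro exI conjI ballI impI; assumption | blast)
  then obtain m where m: "\<And>f. f \<in> ?A \<Longrightarrow> m \<le> (LINT y|M. (f y)\<^sup>2)"
    and m_uniq: "\<And>f h. f \<in> ?A \<Longrightarrow> h \<in> ?A \<Longrightarrow>
        (LINT y|M. (f y)\<^sup>2) = m \<Longrightarrow> (LINT y|M. (h y)\<^sup>2) = m \<Longrightarrow> AE y in M. h y = f y"
    and m_C: "\<And>a. a \<in> ?C \<Longrightarrow> m \<le> (\<Sum>\<^sub>\<infinity>p. (a p)\<^sup>2)"
    and m_ex1: "\<exists>!a. a \<in> ?C \<and> (\<Sum>\<^sub>\<infinity>p. (a p)\<^sup>2) = m"
    by - (elim exE conjE, rule that; (assumption | blast))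
  \<comment> \<open>The bias condition at the sparse point \<open>x0\<close> fixes the mean to be
    gamma(x0), so only the second moment varies among admissible estimators.\<close>
  have var: "var_est \<sigma> H x0 gh = (LINT y|M. (gh y)\<^sup>2) - (\<gamma> x0)\<^sup>2" if "gh \<in> ?A" for gh
  proof -
    interpret prob_space M unfolding M_def by (rule prob_space_gauss[OF sigma])
    have mean: "mean_est \<sigma> H x0 gh = \<gamma> x0"
      using that x0 by (auto simp: admissible_def \<gamma>_def)
    have sq: "gh \<in> sqint M" "(\<lambda>_. 1) \<in> sqint M"
      using that by (auto simp: A moment_set_def sqint_def)
    show ?thesis
      using integral_square_add[OF sq, of "- \<gamma> x0"] mean
      by (simp add: var_est_def mean_est_def obs0 prob_space power2_eq_square)
  qed
  have exp_A: "gh \<in> ?A" "(LINT y|M. (gh y)\<^sup>2) = (\<Sum>\<^sub>\<infinity>p. (a p)\<^sup>2)"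
    if "a \<in> ?C" "hbasis.expands a gh" for a gh
    using hbasis.expands_moment[OF R that(1)[unfolded C] that(2)]
      infsumI[OF hbasis.Parseval[OF that(2)]] by (simp_all add: A M_def)
  have ser_ex: "\<exists>gh. hbasis.expands a gh" if "a \<in> ?C" for a
    using that hbasis.expands_exists by (simp add: C hbasis.coef_solutions_def)
  obtain a1 where a1: "a1 \<in> ?C" "(\<Sum>\<^sub>\<infinity>p. (a1 p)\<^sup>2) = m" using m_ex1 by blast
  \<comment> \<open>The infimum is attained by an expansion of the minimal sequence
    \<open>a1\<close>.\<close>
  have mv: "min_var \<sigma> H S g c x0 = m - (\<gamma> x0)\<^sup>2"
    unfolding min_var_def
  proof (rule cInf_eq_minimum)
    obtain gh where "hbasis.expands a1 gh" using ser_ex[OF a1(1)] by blast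
    from exp_A[OF a1(1) this] show "m - (\<gamma> x0)\<^sup>2 \<in> var_est \<sigma> H x0 ` ?A"
      using a1(2) var by force
  qed (use m var in auto)
  \<comment> \<open>The square root is monotone and \<open>a1\<close> attains m, so being of least
    norm means having square sum m.\<close>
  have min_iff: "(\<forall>a\<in>?C. l2norm a0 \<le> l2norm a) \<longleftrightarrow> (\<Sum>\<^sub>\<infinity>p. (a0 p)\<^sup>2) = m" if "a0 \<in> ?C" for a0
    using m_C m_C[OF that] a1 by (auto simp: l2norm_def intro: antisym)
  have lmv: "is_LMV \<sigma> H S g c x0 gh \<longleftrightarrow> gh \<in> ?A \<and> (LINT y|M. (gh y)\<^sup>2) = m" for gh
    using var by (auto simp: is_LMV_def mv)
  show ?thesis
    unfolding ser mv
  proof (intro conjI)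
    show "\<exists>a\<in>?C. m - (\<gamma> x0)\<^sup>2 = (\<Sum>\<^sub>\<infinity>p. (a p)\<^sup>2) - (\<gamma> x0)\<^sup>2" using a1 by auto
    show "\<forall>a\<in>?C. m - (\<gamma> x0)\<^sup>2 \<le> (\<Sum>\<^sub>\<infinity>p. (a p)\<^sup>2) - (\<gamma> x0)\<^sup>2" using m_C by auto
    show "\<forall>a\<in>?C. (\<exists>gh. hbasis.expands a gh) \<and> (\<forall>gh. hbasis.expands a gh \<longrightarrow> gh \<in> ?A)"
      using ser_ex exp_A(1) by blast
    show "\<exists>!a0. a0 \<in> ?C \<and> (\<forall>a\<in>?C. l2norm a0 \<le> l2norm a)"
      using m_ex1 by (simp add: min_iff cong: conj_cong)
    show "\<forall>a0. a0 \<in> ?C \<and> (\<forall>a\<in>?C. l2norm a0 \<le> l2norm a) \<longrightarrow>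
       (\<forall>gh. hbasis.expands a0 gh \<longrightarrow> is_LMV \<sigma> H S g c x0 gh \<and>
          (\<forall>gh'. is_LMV \<sigma> H S g c x0 gh' \<longrightarrow> (AE y in obs \<sigma> H x0. gh' y = gh y)))"
    proof (intro allI impI)
      fix a0 gh assume "a0 \<in> ?C \<and> (\<forall>a\<in>?C. l2norm a0 \<le> l2norm a)" "hbasis.expands a0 gh"
      hence gh: "gh \<in> ?A \<and> (LINT y|M. (gh y)\<^sup>2) = m"
        using exp_A[of a0 gh] min_iff[of a0] by auto
      thus "is_LMV \<sigma> H S g c x0 gh \<and>
          (\<forall>gh'. is_LMV \<sigma> H S g c x0 gh' \<longrightarrow> (AE y in obs \<sigma> H x0. gh' y = gh y))"
        unfolding lmv obs0 using m_uniq by auto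
    qed
  qed
qed

end
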